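(* Let $d \geq 2$ and let $k$ be a positive integer such that $\ell = k^{1/d}$ is an integer that is a multiple of $20$. For every $d$-dimensional $k\times \cdots \times k$ permutation matrix $P$ that has a corner $1$-entry and contains $R^{\ell, \ldots, \ell}$ as an interval minor, we have $\frac{f(n,P,d)}{n^{d-1}}=2^{\Omega(k^{1 / d})}$ for all $n \geq 2^{ k^{1/d}/20}$.
   Context: A $d$-dimensional $0$-$1$ matrix $A$ contains a $d$-dimensional $0$-$1$ matrix $P$ if $A$ has a submatrix (obtained by selecting a subset of indices in each coordinate) that can be turned into $P$ by changing some ones to zeroes; otherwise $A$ avoids $P$. $f(n,P,d)$ is the maximum number of ones in a $d$-dimensional $n\times\cdots\times n$ $0$-$1$ matrix that avoids $P$. An $\ell$-cross section of a matrix is the set of entries with the $\ell$-th coordinate fixed. A $d$-dimensional $k\times\cdots\times k$ $0$-$1$ matrix is a permutation matrix if each of its cross sections (in every direction) contains exactly one $1$. Contracting several consecutive $\ell$-cross sections means replacing them with a single $\ell$-cross section whose entry is $1$ iff at least one of the corresponding original entries is $1$. $A$ contains $B$ as an interval minor if repeated cross-section contractions transform $A$ into a matrix that contains $B$. $R^{k_1,\ldots,k_d}$ is the $d$-dimensional $k_1\times\cdots\times k_d$ all-ones matrix. A corner entry of a $k_1\times\cdots\times k_d$ matrix is an entry $p_{i_1,\ldots,i_d}$ with $i_\tau\in\{1,k_\tau\}$ for every $\tau$. The $\Omega$ is with respect to $k$, with implied constant possibly depending on $d$. *)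

theory Defs
  imports Complex_Main "HOL-Library.FuncSet"
begin

text \<open>
  A $d$-dimensional matrix of shape \<open>s\<close> (side length \<open>s t\<close> in direction \<open>t < d\<close>; the values of
  \<open>s\<close> at \<open>t \<ge> d\<close> are irrelevant) is a function on the index set \<open>indices d s\<close>.  Directions and
  indices are counted from 0.  The shape is always passed explicitly next to the matrix.
\<close>

type_synonym shape = "nat \<Rightarrow> nat"
type_synonym index = "nat \<Rightarrow> nat"
type_synonym matrix = "index \<Rightarrow> nat"

definition indices :: "nat \<Rightarrow> shape \<Rightarrow> index set" where
  "indices d s = (\<Pi>\<^sub>E t\<in>{..<d}. {..<s t})"

definition zo_matrices :: "nat \<Rightarrow> shape \<Rightarrow> matrix set" where
  "zo_matrices d s = indices d s \<rightarrow>\<^sub>E {0, 1}"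

definition ones :: "nat \<Rightarrow> shape \<Rightarrow> matrix \<Rightarrow> nat" where
  "ones d s A = card {i \<in> indices d s. A i = 1}"

definition all_ones :: "nat \<Rightarrow> shape \<Rightarrow> matrix" where
  "all_ones d s = (\<lambda>i\<in>indices d s. 1)"

text \<open>
  The submatrix of \<open>A\<close> obtained by selecting the finite set of indices \<open>S t\<close> in each direction
  \<open>t\<close>; it has shape \<open>\<lambda>t. card (S t)\<close>, and its \<open>j\<close>-th cross section in direction \<open>t\<close> comes from
  the \<open>j\<close>-th smallest element of \<open>S t\<close>.
\<close>

definition submatrix :: "nat \<Rightarrow> (nat \<Rightarrow> nat set) \<Rightarrow> matrix \<Rightarrow> matrix" where
  "submatrix d S A =
     (\<lambda>i\<in>indices d (\<lambda>t. card (S t)). A (\<lambda>t\<in>{..<d}. sorted_list_of_set (S t) ! i t))"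

text \<open>
  For 0-1 matrices, the pointwise \<open>\<le>\<close> below says that \<open>P\<close> arises from the submatrix by changing
  some (possibly no) ones to zeroes.
\<close>

definition contains :: "nat \<Rightarrow> shape \<Rightarrow> matrix \<Rightarrow> shape \<Rightarrow> matrix \<Rightarrow> bool" where
  "contains d a A p P \<longleftrightarrow>
     (\<exists>S. (\<forall>t<d. S t \<subseteq> {..<a t} \<and> card (S t) = p t) \<and>
          (\<forall>i\<in>indices d p. P i \<le> submatrix d S A i))"

abbreviation avoids :: "nat \<Rightarrow> shape \<Rightarrow> matrix \<Rightarrow> shape \<Rightarrow> matrix \<Rightarrow> bool" where
  "avoids d a A p P \<equiv> \<not> contains d a A p P"

text \<open>The extremal function $f(n,P,d)$ for a matrix \<open>P\<close> of shape \<open>p\<close>.\<close>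

definition ex_fun :: "nat \<Rightarrow> shape \<Rightarrow> matrix \<Rightarrow> nat \<Rightarrow> nat" where
  "ex_fun n p P d =
     Max {ones d (\<lambda>_. n) A | A. A \<in> zo_matrices d (\<lambda>_. n) \<and> avoids d (\<lambda>_. n) A p P}"

definition cross_section :: "nat \<Rightarrow> shape \<Rightarrow> nat \<Rightarrow> nat \<Rightarrow> index set" where
  "cross_section d s t j = {i \<in> indices d s. i t = j}"

definition permutation_matrix :: "nat \<Rightarrow> nat \<Rightarrow> matrix \<Rightarrow> bool" where
  "permutation_matrix d k P \<longleftrightarrow>
     P \<in> zo_matrices d (\<lambda>_. k) \<and>
     (\<forall>t<d. \<forall>j<k. \<exists>!i. i \<in> cross_section d (\<lambda>_. k) t j \<and> P i = 1)"

definition has_corner_one :: "nat \<Rightarrow> shape \<Rightarrow> matrix \<Rightarrow> bool" where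
  "has_corner_one d s P \<longleftrightarrow>
     (\<exists>i\<in>indices d s. (\<forall>t<d. i t \<in> {0, s t - 1}) \<and> P i = 1)"

text \<open>
  Contracting the consecutive cross sections \<open>u, \<dots>, v\<close> in direction \<open>t\<close>: the cross section with
  old position \<open>y\<close> becomes (part of) the one with new position \<open>collapse u v y\<close>.
\<close>

definition collapse :: "nat \<Rightarrow> nat \<Rightarrow> nat \<Rightarrow> nat" where
  "collapse u v y = (if y < u then y else if y \<le> v then u else y - (v - u))"

definition contract_shape :: "nat \<Rightarrow> nat \<Rightarrow> nat \<Rightarrow> shape \<Rightarrow> shape" where
  "contract_shape t u v a = a(t := a t - (v - u))"

definition contract :: "nat \<Rightarrow> nat \<Rightarrow> nat \<Rightarrow> nat \<Rightarrow> shape \<Rightarrow> matrix \<Rightarrow> matrix" where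
  "contract d t u v a A =
     (\<lambda>i\<in>indices d (contract_shape t u v a).
        if \<exists>x\<in>indices d a. x(t := collapse u v (x t)) = i \<and> A x = 1 then 1 else 0)"

inductive contracts_to :: "nat \<Rightarrow> shape \<Rightarrow> matrix \<Rightarrow> shape \<Rightarrow> matrix \<Rightarrow> bool" for d where
  refl: "contracts_to d a A a A"
| step: "contracts_to d a A b B \<Longrightarrow> t < d \<Longrightarrow> u \<le> v \<Longrightarrow> v < b t \<Longrightarrow>
    contracts_to d a A (contract_shape t u v b) (contract d t u v b B)"

definition interval_minor :: "nat \<Rightarrow> shape \<Rightarrow> matrix \<Rightarrow> shape \<Rightarrow> matrix \<Rightarrow> bool" where
  "interval_minor d a A b B \<longleftrightarrow> (\<exists>c C. contracts_to d a A c C \<and> contains d c C b B)"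

end

theory Submission
  imports Defs
begin

text \<open>
  Let $N = 2^r$ and let the nodes of the complete binary tree of depth $r$ stand for the dyadic
  intervals of $\{0,\dots,N-1\}$.  Kill each $d$-tuple of nodes independently with probability
  $1/m$, and keep a cell iff no $d$-tuple of ancestors of its coordinates is killed.  If the
  surviving cells have $R^{\ell,\dots,\ell}$ as an interval minor, the smallest dyadic intervals
  around the $\ell$ disjoint intervals in a direction are distinct, and the ancestors of these
  nodes contain a rooted subtree with $\ell$ nodes; no tuple in the product of the $d$ subtrees is
  killed.  There are at most $4^\ell$ rooted subtrees with $\ell$ nodes, hence a union bound over
  $4^{d\ell}$ products, each of $\ell^d$ tuples, suffices.  Counting subtrees instead of arbitrary
  families of $\ell$ intervals is what allows $r$ to be linear in $\ell$: with $m$ of order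
  $\ell^{d-1}$ a cell survives with probability $2^{-r/2}$ or more.

  Larger $n$ are reached by placing copies of this matrix in an antichain of blocks; the corner
  one of $P$ confines a copy of $P$ to a single block.  For small $\ell$ two full cross sections
  already give the ratio 2.
\<close>

subsection \<open>Counting rooted subtrees of the binary tree\<close>

text \<open>Nodes are numbered as in a binary heap: the root is 1 and the parent of \<open>v\<close> is \<open>v div 2\<close>.\<close>

definition rooted :: "nat set \<Rightarrow> bool" where
  "rooted T \<longleftrightarrow> 0 \<notin> T \<and> (\<forall>v\<in>T. 2 \<le> v \<longrightarrow> v div 2 \<in> T)"

definition rank :: "nat set \<Rightarrow> nat \<Rightarrow> nat" where
  "rank T v = card {u \<in> T. u < v}"

text \<open>
  Each node is recorded by the rank of its parent and its side.  Since parents precede children,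
  the tree can be recovered from this set, a subset of \<open>{..<2 * card T}\<close>.
\<close>

definition code :: "nat set \<Rightarrow> nat set" where
  "code T = (\<lambda>v. 2 * rank T (v div 2) + v mod 2) ` (T - {1})"

lemma rank_less_rank:
  assumes "finite T" "u \<in> T" "u < v"
  shows "rank T u < rank T v"
  unfolding rank_def by (rule psubset_card_mono) (use assms in auto)

lemma rank_inj:
  assumes "finite T" "u \<in> T" "v \<in> T" "rank T u = rank T v"
  shows "u = v"
  using assms rank_less_rank[of T u v] rank_less_rank[of T v u] by (metis less_irrefl linorder_neqE_nat)

lemma one_in_rooted:
  assumes "rooted T" "T \<noteq> {}"
  shows "1 \<in> T"
proof -
  obtain v where "v \<in> T" using assms by auto
  then show ?thesis
  proof (induction v rule: less_induct)
    case (less v)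
    show ?case
    proof (cases "2 \<le> v")
      case True
      then have "v div 2 \<in> T" "v div 2 < v" using less.prems assms by (auto simp: rooted_def)
      then show ?thesis using less.IH by blast
    next
      case False
      moreover have "v \<noteq> 0" using less.prems assms by (metis rooted_def)
      ultimately have "v = 1" by simp
      then show ?thesis using less.prems by simp
    qed
  qed
qed

text \<open>One direction of the inductive step for the injectivity of \<open>code\<close>.
  Agreement below \<open>w\<close> gives the parent of \<open>w\<close> the same rank in both trees,
  so in \<open>T'\<close> the code entry of \<open>w\<close> can only come from the child of that
  parent on the same side, which is \<open>w\<close>.\<close>

lemma code_step:
  assumes "finite T'" "rooted T" "rooted T'" "T' \<noteq> {}" "code T \<subseteq> code T'"
    and "w \<in> T" and agree: "\<And>u. u < w \<Longrightarrow> u \<in> T \<longleftrightarrow> u \<in> T'"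
  shows "w \<in> T'"
proof (cases "2 \<le> w")
  case True
  have p: "w div 2 \<in> T" "w div 2 < w" using assms(2,6) True by (auto simp: rooted_def)
  then have p': "w div 2 \<in> T'" using agree[OF p(2)] by simp
  have "{u \<in> T. u < w div 2} = {u \<in> T'. u < w div 2}"
  proof (rule Collect_cong)
    show "(u \<in> T \<and> u < w div 2) = (u \<in> T' \<and> u < w div 2)" for u
      using agree[OF less_trans[OF _ p(2)], of u] by metis
  qed
  then have r: "rank T (w div 2) = rank T' (w div 2)" by (simp add: rank_def)
  have c: "2 * rank T (w div 2) + w mod 2 \<in> code T"
    unfolding code_def by (rule image_eqI[of _ _ w]) (use True assms(6) in auto)
  have "2 * rank T (w div 2) + w mod 2 \<in> code T'" by (rule subsetD[OF assms(5) c])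
  then obtain v where "v \<in> T' - {1}"
    and v3: "2 * rank T (w div 2) + w mod 2 = 2 * rank T' (v div 2) + v mod 2"
    unfolding code_def by (rule imageE)
  then have v: "v \<in> T'" "v \<noteq> 1" by simp_all
  have eq: "rank T' (w div 2) = rank T' (v div 2)" "w mod 2 = v mod 2"
    using v3 unfolding r by presburger+
  have "v \<noteq> 0" using v(1) assms(3) by (metis rooted_def)
  then have "v div 2 \<in> T'" using v(1,2) assms(3) by (auto simp: rooted_def)
  then have "w div 2 = v div 2" by (rule rank_inj[OF assms(1) p' _ eq(1)])
  then have "w = v" using eq(2) by (metis div_mult_mod_eq)
  then show ?thesis using v(1) by simp
next
  case False
  moreover have "w \<noteq> 0" using assms(2,6) by (metis rooted_def)
  ultimately have "w = 1" by simp
  then show ?thesis using one_in_rooted[OF assms(3,4)] by simp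
qed

text \<open>Parents have rank below \<open>l\<close>, so \<open>code\<close> embeds these trees into
  the subsets of \<open>{..<2 * l}\<close>. The bound therefore does not depend on \<open>V\<close>,
  that is, on the depth of the ambient tree.\<close>

lemma card_rooted:
  assumes "1 \<le> l" "finite V"
  shows "card {T. rooted T \<and> T \<subseteq> V \<and> card T = l} \<le> 4 ^ l"
proof -
  let ?R = "{T. rooted T \<and> T \<subseteq> V \<and> card T = l}"
  have R: "finite T" "rooted T" "T \<noteq> {}" if "T \<in> ?R" for T
    using that assms by (auto intro: finite_subset)
  have "inj_on code ?R"
  proof (rule inj_onI)
    fix T T' assume TT: "T \<in> ?R" "T' \<in> ?R" "code T = code T'"
    have "w \<in> T \<longleftrightarrow> w \<in> T'" for w
    proof (induction w rule: less_induct)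
      case (less w)
      show ?case
        using code_step[OF R(1)[OF TT(2)] R(2)[OF TT(1)] R(2)[OF TT(2)] R(3)[OF TT(2)]
            equalityD1[OF TT(3)] _ less.IH]
          code_step[OF R(1)[OF TT(1)] R(2)[OF TT(2)] R(2)[OF TT(1)] R(3)[OF TT(1)]
            equalityD2[OF TT(3)] _ less.IH[symmetric]]
        by (rule iffI)
    qed
    then show "T = T'" by blast
  qed
  moreover have "code ` ?R \<subseteq> Pow {..<2 * l}"
  proof (rule image_subsetI, rule PowI, rule subsetI)
    fix T c assume "T \<in> ?R" "c \<in> code T"
    then have T: "rooted T" "T \<subseteq> V" "card T = l" "c \<in> code T" by auto
    from T(4) obtain v where "v \<in> T - {1}" and v3: "c = 2 * rank T (v div 2) + v mod 2"
      unfolding code_def by (rule imageE)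
    then have v: "v \<in> T" "v \<noteq> 1" by simp_all
    have "v \<noteq> 0" using v(1) T(1) by (metis rooted_def)
    then have "v div 2 \<in> T" using v T(1) by (auto simp: rooted_def)
    then have "{u \<in> T. u < v div 2} \<subset> T" by auto
    then have "rank T (v div 2) < card T" unfolding rank_def
      using finite_subset[OF T(2) assms(2)] by (intro psubset_card_mono)
    then show "c \<in> {..<2 * l}" using v3 T(3) by auto
  qed
  ultimately have "card ?R \<le> card (Pow {..<2 * l})"
    by (rule card_inj_on_le) simp
  also have "\<dots> = 4 ^ l" by (simp add: card_Pow power_mult)
  finally show ?thesis .
qed

text \<open>Children have larger numbers than their parents, so the largest node of a finite rooted
  set has no child in it and can be removed.\<close>

lemma rooted_trim:
  assumes "finite T" "rooted T" "l \<le> card T"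
  shows "\<exists>T'\<subseteq>T. rooted T' \<and> card T' = l"
  using assms
proof (induction "card T - l" arbitrary: T)
  case 0
  then show ?case by auto
next
  case (Suc m)
  then have ne: "T \<noteq> {}" by auto
  let ?T = "T - {Max T}"
  have c: "card ?T = card T - 1" using Suc ne by simp
  have "rooted ?T"
    unfolding rooted_def
  proof (intro conjI ballI impI)
    show "0 \<notin> ?T" using Suc by (auto simp: rooted_def)
    fix v assume v: "v \<in> ?T" "2 \<le> v"
    then have "v div 2 \<in> T" using Suc by (auto simp: rooted_def)
    moreover have "v div 2 < v" using v by simp
    moreover have "v \<le> Max T" using v Suc by auto
    ultimately show "v div 2 \<in> ?T" by auto
  qed
  moreover have "finite ?T" "m = card ?T - l" "l \<le> card ?T" using Suc.hyps(2) Suc.prems c by auto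
  ultimately obtain T' where "T' \<subseteq> ?T" "rooted T'" "card T' = l"
    using Suc.hyps(1)[of ?T] by auto
  then show ?case by auto
qed

subsection \<open>Ancestors of the leaves\<close>

text \<open>The condition \<open>1 \<le> v\<close> stops the halvings at the root, so that 0 never
  counts as a node. A node is its own ancestor.\<close>

definition anc :: "nat \<Rightarrow> nat set" where
  "anc x = {v. 1 \<le> v \<and> (\<exists>s. v = x div 2 ^ s)}"

lemma rooted_anc: "rooted (anc x)"
  unfolding rooted_def
proof (intro conjI ballI impI)
  show "0 \<notin> anc x" by (simp add: anc_def)
  fix v assume "v \<in> anc x" "2 \<le> v"
  then obtain s where "v = x div 2 ^ s" by (auto simp: anc_def)
  then have "v div 2 = x div 2 ^ Suc s" by (simp add: div_mult2_eq[symmetric] mult.commute)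
  moreover have "1 \<le> v div 2" using \<open>2 \<le> v\<close> by simp
  ultimately show "v div 2 \<in> anc x" unfolding anc_def by blast
qed

lemma anc_trans: "w \<in> anc v \<Longrightarrow> v \<in> anc x \<Longrightarrow> w \<in> anc x"
  unfolding anc_def by (auto simp: div_mult2_eq[symmetric] power_add[symmetric])

lemma anc_self: "1 \<le> v \<Longrightarrow> v \<in> anc v"
  unfolding anc_def by (auto intro: exI[of _ 0])

lemma anc_le: "v \<in> anc x \<Longrightarrow> 1 \<le> v \<and> v \<le> x"
  unfolding anc_def by auto

lemma card_anc:
  assumes "x < 2 ^ Suc r"
  shows "card (anc x) \<le> Suc r"
proof -
  have "anc x \<subseteq> (\<lambda>s. x div 2 ^ s) ` {..r}"
  proof
    fix v assume "v \<in> anc x"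
    then obtain s where s: "1 \<le> v" "v = x div 2 ^ s" by (auto simp: anc_def)
    have "s \<le> r"
    proof (rule ccontr)
      assume "\<not> s \<le> r"
      then have "(2::nat) ^ Suc r \<le> 2 ^ s" by (intro power_increasing) auto
      then show False using s assms by simp
    qed
    then show "v \<in> (\<lambda>s. x div 2 ^ s) ` {..r}" using s by auto
  qed
  then have "card (anc x) \<le> card ((\<lambda>s. x div 2 ^ s) ` {..r})" by (intro card_mono) auto
  also have "\<dots> \<le> Suc r" using card_image_le[of "{..r}"] by simp
  finally show ?thesis .
qed

section \<open>Lowest common ancestors, or smallest dyadic intervals around two points\<close>

definition jlevel :: "nat \<Rightarrow> nat \<Rightarrow> nat" where
  "jlevel a b = (LEAST s. a div 2 ^ s = b div 2 ^ s)"

text \<open>For two leaves this is their lowest common ancestor, and \<open>jlevel\<close> is its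
  height above the leaves.\<close>

definition join :: "nat \<Rightarrow> nat \<Rightarrow> nat" where
  "join a b = a div 2 ^ jlevel a b"

text \<open>The nodes of depth \<open>i\<close> are the heap numbers in
  \<open>{2 ^ i..<2 ^ Suc i}\<close>; the leaves have depth \<open>r\<close>, and each halving goes
  up by one.\<close>

lemma div_leaf:
  fixes a :: nat
  assumes "a \<in> {2 ^ r..<2 ^ Suc r}" "s \<le> r"
  shows "a div 2 ^ s \<in> {2 ^ (r - s)..<2 ^ Suc (r - s)}"
proof -
  have r: "(2::nat) ^ r = 2 ^ (r - s) * 2 ^ s" "(2::nat) ^ Suc r = 2 ^ Suc (r - s) * 2 ^ s"
    using assms(2) by (simp_all add: power_add[symmetric])
  have "2 ^ (r - s) * 2 ^ s \<le> a" "a < 2 ^ Suc (r - s) * 2 ^ s"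
    using assms(1) r by auto
  then have "2 ^ (r - s) \<le> a div 2 ^ s" "a div 2 ^ s < 2 ^ Suc (r - s)"
    by (auto simp: less_eq_div_iff_mult_less_eq intro: less_mult_imp_div_less simp del: power_Suc)
  then show ?thesis by simp
qed

lemma jlevel:
  assumes "a \<in> {2 ^ r..<2 ^ Suc r}" "b \<in> {2 ^ r..<2 ^ Suc r}"
  shows "jlevel a b \<le> r" "a div 2 ^ jlevel a b = b div 2 ^ jlevel a b"
proof -
  have "a div 2 ^ r = b div 2 ^ r"
    using div_leaf[OF assms(1), of r] div_leaf[OF assms(2), of r] by auto
  then show "jlevel a b \<le> r" "a div 2 ^ jlevel a b = b div 2 ^ jlevel a b"
    unfolding jlevel_def
    by (rule Least_le, rule LeastI[of "\<lambda>s. a div 2 ^ s = b div 2 ^ s"])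
qed

lemma join_range:
  assumes "a \<in> {2 ^ r..<2 ^ Suc r}" "b \<in> {2 ^ r..<2 ^ Suc r}"
  shows "join a b \<in> {2 ^ (r - jlevel a b)..<2 ^ Suc (r - jlevel a b)}"
  unfolding join_def by (rule div_leaf[OF assms(1) jlevel(1)[OF assms]])

text \<open>Division is monotone, so every number between \<open>a\<close> and \<open>b\<close> is
  squeezed to the same node at height \<open>jlevel a b\<close>.\<close>

lemma join_in_anc:
  assumes "a \<in> {2 ^ r..<2 ^ Suc r}" "b \<in> {2 ^ r..<2 ^ Suc r}" "a \<le> x" "x \<le> b"
  shows "join a b \<in> anc x"
proof -
  let ?s = "jlevel a b"
  have "a div 2 ^ ?s \<le> x div 2 ^ ?s" "x div 2 ^ ?s \<le> b div 2 ^ ?s"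
    using assms by (auto intro: div_le_mono)
  then have "join a b = x div 2 ^ ?s" using jlevel(2)[OF assms(1,2)] by (simp add: join_def)
  moreover have "1 \<le> join a b" using join_range[OF assms(1,2)]
    by (metis atLeastLessThan_iff le_trans one_le_numeral one_le_power)
  ultimately show ?thesis by (auto simp: anc_def)
qed

text \<open>Only two numbers have a given half, so a chain of numbers with this half cannot increase
  strictly twice.\<close>

lemma siblings_le:
  fixes a b a' b' :: nat
  assumes "a div 2 = b'  div 2" "a \<le> b" "b \<le> a'" "a' \<le> b'"
  shows "a = b \<or> a' = b'"
proof -
  define v where "v = a div 2"
  have "2 * v \<le> a" by (simp add: v_def)
  moreover have "b' = 2 * v + b' mod 2" by (simp add: v_def assms(1))
  moreover have "b' mod 2 < 2" by simp
  ultimately show ?thesis using assms(2-4) by linarith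
qed

text \<open>An interval meets both subtrees below its join, so the join determines it among disjoint intervals.\<close>

lemma join_neq:
  assumes "a \<in> {2 ^ r..<2 ^ Suc r}" "b \<in> {2 ^ r..<2 ^ Suc r}"
    and "a' \<in> {2 ^ r..<2 ^ Suc r}" "b' \<in> {2 ^ r..<2 ^ Suc r}"
    and "a \<le> b" "b < a'" "a' \<le> b'"
  shows "join a b \<noteq> join a' b'"
proof
  assume eq: "join a b = join a' b'"
  have no: "\<not> i < j" if "v \<in> {2 ^ i..<2 ^ Suc i}" "v \<in> {2 ^ j..<2 ^ Suc j}" for v i j :: nat
  proof
    assume "i < j"
    then have "(2::nat) ^ Suc i \<le> 2 ^ j" by (intro power_increasing) auto
    then show False using that by auto
  qed
  \<comment> \<open>Different depths occupy disjoint ranges of heap numbers, so a common join has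
    the same height for both intervals.\<close>
  have "r - jlevel a b = r - jlevel a' b'"
    using no join_range[OF assms(1,2)] join_range[OF assms(3,4)] eq
    by (metis linorder_neqE_nat)
  then have s: "jlevel a b = jlevel a' b'"
    using jlevel(1)[OF assms(1,2)] jlevel(1)[OF assms(3,4)] by simp
  show False
  proof (cases "jlevel a b")
    case 0
    then show False using eq s assms jlevel(2)[OF assms(1,2)] by (simp add: join_def)
  next
    case (Suc s)
    \<comment> \<open>One level below the join the two ends are still apart, by minimality of
      \<open>jlevel\<close>. Both intervals would then have to separate the same two
      children.\<close>
    have ne: "a div 2 ^ s \<noteq> b div 2 ^ s"
      using not_less_Least[of s "\<lambda>s. a div 2 ^ s = b div 2 ^ s"] Suc by (simp add: jlevel_def)
    have ne': "a' div 2 ^ s \<noteq> b' div 2 ^ s"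
      using not_less_Least[of s "\<lambda>s. a' div 2 ^ s = b' div 2 ^ s"] Suc \<open>jlevel a b = jlevel a' b'\<close>
      by (simp add: jlevel_def)
    have D: "x div 2 ^ Suc s = x div 2 ^ s div 2" for x :: nat
      by (simp add: div_mult2_eq[symmetric] mult.commute)
    have "a div 2 ^ s div 2 = b div 2 ^ s div 2" "a div 2 ^ s div 2 = a' div 2 ^ s div 2"
      "a' div 2 ^ s div 2 = b' div 2 ^ s div 2"
      using jlevel(2)[OF assms(1,2)] jlevel(2)[OF assms(3,4)] eq
      unfolding join_def s[symmetric] Suc D by auto
    moreover have "a div 2 ^ s \<le> b div 2 ^ s" "b div 2 ^ s \<le> a' div 2 ^ s" "a' div 2 ^ s \<le> b' div 2 ^ s"
      using assms by (auto intro: div_le_mono)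
    ultimately show False
      using ne ne' siblings_le[of "a div 2 ^ s" "b div 2 ^ s" "a' div 2 ^ s" "b' div 2 ^ s"] by auto
  qed
qed

subsection \<open>Grids and products of rooted subtrees\<close>

text \<open>
  For the set of ones of a matrix this says that $R^{l,\dots,l}$ is an interval minor: \<open>y j\<close> is a
  one in the \<open>j\<close>-th block.
\<close>

definition grid :: "nat \<Rightarrow> nat \<Rightarrow> index set \<Rightarrow> bool" where
  "grid d l X \<longleftrightarrow> (\<exists>y. (\<forall>j\<in>indices d (\<lambda>_. l). y j \<in> X) \<and>
     (\<forall>j\<in>indices d (\<lambda>_. l). \<forall>j'\<in>indices d (\<lambda>_. l). \<forall>t<d. j t < j' t \<longrightarrow> y j t < y j' t))"

lemma gridE:
  assumes "grid d l X"
  obtains y where "\<And>j. j \<in> indices d (\<lambda>_. l) \<Longrightarrow> y j \<in> X"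
    and "\<And>j j' t. j \<in> indices d (\<lambda>_. l) \<Longrightarrow> j' \<in> indices d (\<lambda>_. l) \<Longrightarrow> t < d \<Longrightarrow>
      j t < j' t \<Longrightarrow> y j t < y j' t"
proof -
  from assms obtain y where y: "(\<forall>j\<in>indices d (\<lambda>_. l). y j \<in> X) \<and>
     (\<forall>j\<in>indices d (\<lambda>_. l). \<forall>j'\<in>indices d (\<lambda>_. l). \<forall>t<d. j t < j' t \<longrightarrow> y j t < y j' t)"
    unfolding grid_def by (rule exE)
  show thesis
    by (rule that[of y]; use y in simp)
qed

lemma grid_image:
  assumes "grid d l X" and "\<And>x. x \<in> X \<Longrightarrow> f x \<in> Y"
    and "\<And>x x' t. x \<in> X \<Longrightarrow> x' \<in> X \<Longrightarrow> t < d \<Longrightarrow> x t < x' t \<Longrightarrow> f x t < f x' t"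
  shows "grid d l Y"
proof -
  from assms(1) obtain y where y: "\<And>j. j \<in> indices d (\<lambda>_. l) \<Longrightarrow> y j \<in> X"
    and ord: "\<And>j j' t. j \<in> indices d (\<lambda>_. l) \<Longrightarrow> j' \<in> indices d (\<lambda>_. l) \<Longrightarrow> t < d \<Longrightarrow>
      j t < j' t \<Longrightarrow> y j t < y j' t"
    by (rule gridE) blast
  show ?thesis unfolding grid_def
  proof (rule exI[of _ "\<lambda>j. f (y j)"], intro conjI ballI allI impI)
    show "f (y j) \<in> Y" if "j \<in> indices d (\<lambda>_. l)" for j
      by (rule assms(2)[OF y[OF that]])
    show "f (y j) t < f (y j') t"
      if "j \<in> indices d (\<lambda>_. l)" "j' \<in> indices d (\<lambda>_. l)" "t < d" "j t < j' t" for j j' t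
      by (rule assms(3)[OF y[OF that(1)] y[OF that(2)] that(3) ord[OF that]])
  qed
qed

text \<open>In direction \<open>t\<close> the points of block \<open>i\<close> span an interval with
  join \<open>D t i\<close>. The \<open>l\<close> joins are distinct, so their ancestors form a
  rooted set with at least \<open>l\<close> nodes, which is trimmed to \<open>l\<close>. A tuple of
  the product lies above one block in every direction, and the grid point with these block indices
  lies below all its entries.\<close>

lemma grid_rooted:
  assumes "grid d l X" "X \<subseteq> indices d (\<lambda>_. 2 ^ r)" "1 \<le> l"
  shows "\<exists>T. (\<forall>t<d. rooted (T t) \<and> T t \<subseteq> {1..<2 ^ Suc r} \<and> card (T t) = l) \<and>
    (\<forall>u\<in>PiE {..<d} T. \<exists>x\<in>X. u \<in> PiE {..<d} (\<lambda>t. anc (2 ^ r + x t)))"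
proof -
  from assms(1) obtain y where y: "\<And>j. j \<in> indices d (\<lambda>_. l) \<Longrightarrow> y j \<in> X"
    and ord: "\<And>j j' t. j \<in> indices d (\<lambda>_. l) \<Longrightarrow> j' \<in> indices d (\<lambda>_. l) \<Longrightarrow> t < d \<Longrightarrow>
      j t < j' t \<Longrightarrow> y j t < y j' t"
    by (rule gridE) blast
  \<comment> \<open>Coordinate \<open>x\<close> of the dyadic grid is the leaf with heap number
    \<open>2 ^ r + x\<close>.\<close>
  define Y where "Y t i = (\<lambda>j. 2 ^ r + y j t) ` {j \<in> indices d (\<lambda>_. l). j t = i}" for t i
  define a where "a t i = Min (Y t i)" for t i
  define b where "b t i = Max (Y t i)" for t i
  define D where "D t i = join (a t i) (b t i)" for t i
  have finI: "finite (indices d (\<lambda>_. l))" by (simp add: indices_def finite_PiE)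
  have fin: "finite (Y t i)" for t i unfolding Y_def using finI by simp
  have sub: "Y t i \<subseteq> {2 ^ r..<2 ^ Suc r}" if "t < d" for t i
  proof -
    have "y j t < 2 ^ r" if "j \<in> indices d (\<lambda>_. l)" for j
    proof -
      have "y j \<in> indices d (\<lambda>_. 2 ^ r)" using y[OF that] assms(2) by blast
      then show ?thesis using \<open>t < d\<close> by (auto simp: indices_def)
    qed
    then show ?thesis by (auto simp: Y_def)
  qed
  have ne: "Y t i \<noteq> {}" if "t < d" "i < l" for t i
  proof -
    have "(\<lambda>t\<in>{..<d}. i) \<in> {j \<in> indices d (\<lambda>_. l). j t = i}"
      using that by (auto simp: indices_def)
    then show ?thesis unfolding Y_def by blast
  qed
  have ab: "a t i \<in> {2 ^ r..<2 ^ Suc r}" "b t i \<in> {2 ^ r..<2 ^ Suc r}" "a t i \<le> b t i"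
    if "t < d" "i < l" for t i
  proof -
    have "a t i \<in> Y t i" "b t i \<in> Y t i" using fin ne[OF that] by (auto simp: a_def b_def)
    then show "a t i \<in> {2 ^ r..<2 ^ Suc r}" "b t i \<in> {2 ^ r..<2 ^ Suc r}"
      using sub[OF that(1), of i] by blast+
    show "a t i \<le> b t i"
      using \<open>a t i \<in> Y t i\<close> fin by (simp add: b_def)
  qed
  have sep: "b t i < a t i'" if "t < d" "i < l" "i' < l" "i < i'" for t i i'
  proof -
    have "a t i' \<in> Y t i'" using fin ne[OF that(1,3)] by (simp add: a_def)
    then obtain j' where j': "a t i' = 2 ^ r + y j' t" "j' \<in> {j \<in> indices d (\<lambda>_. l). j t = i'}"
      unfolding Y_def by (rule imageE)
    have "b t i \<in> Y t i" using fin ne[OF that(1,2)] by (simp add: b_def)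
    then obtain j where j: "b t i = 2 ^ r + y j t" "j \<in> {j \<in> indices d (\<lambda>_. l). j t = i}"
      unfolding Y_def by (rule imageE)
    have "y j t < y j' t" using j(2) j'(2) that by (intro ord) auto
    then show ?thesis by (simp add: j(1) j'(1))
  qed
  have inj: "inj_on (D t) {..<l}" if t: "t < d" for t
  proof (rule inj_onI)
    fix i i' assume i: "i \<in> {..<l}" "i' \<in> {..<l}" "D t i = D t i'"
    have "D t i \<noteq> D t i'" if "i < i'" "i < l" "i' < l" for i i'
      unfolding D_def 
      by (rule join_neq[OF ab(1,2)[OF t that(2)] ab(1,2)[OF t that(3)] ab(3)[OF t that(2)]
            sep[OF t that(2,3,1)] ab(3)[OF t that(3)]])
    then show "i = i'" using i by (metis lessThan_iff linorder_neqE_nat)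
  qed
  have Danc: "D t i \<in> anc x" if "t < d" "i < l" "x \<in> Y t i" for t i x
    unfolding D_def
    by (rule join_in_anc[OF ab(1,2)]) (use that fin in \<open>auto simp: a_def b_def\<close>)
  define T0 where "T0 t = (\<Union>i<l. anc (D t i))" for t
  have D1: "1 \<le> D t i" "D t i < 2 ^ Suc r" if "t < d" "i < l" for t i
  proof -
    have "D t i \<in> anc (a t i)"
      by (rule Danc[OF that]) (use fin ne[OF that] in \<open>simp add: a_def\<close>)
    then show "1 \<le> D t i" "D t i < 2 ^ Suc r"
      using anc_le[of "D t i" "a t i"] ab(1)[OF that] by auto
  qed
  have "\<exists>T\<subseteq>T0 t. rooted T \<and> T \<subseteq> {1..<2 ^ Suc r} \<and> card T = l" if t: "t < d" for t
  proof -
    have "T0 t \<subseteq> {1..<2 ^ Suc r}"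
    proof
      fix v assume "v \<in> T0 t"
      then obtain i where "i < l" "v \<in> anc (D t i)" by (auto simp: T0_def)
      then show "v \<in> {1..<2 ^ Suc r}" using D1(2)[OF t, of i] anc_le[of v "D t i"] by simp
    qed
    moreover from this have f: "finite (T0 t)" by (rule finite_subset) simp
    moreover have "rooted (T0 t)"
      unfolding T0_def using rooted_anc by (simp add: rooted_def) blast
    moreover have "l \<le> card (T0 t)"
    proof -
      have "card (D t ` {..<l}) \<le> card (T0 t)"
        by (rule card_mono[OF f]) (use anc_self[OF D1(1)[OF t]] in \<open>auto simp: T0_def\<close>)
      then show ?thesis by (simp add: card_image[OF inj[OF t]])
    qed
    ultimately show ?thesis using rooted_trim[of "T0 t" l] by (meson subset_trans)
  qed
  then have "\<forall>t. \<exists>T. t < d \<longrightarrow> T \<subseteq> T0 t \<and> rooted T \<and> T \<subseteq> {1..<2 ^ Suc r} \<and> card T = l"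
    by blast
  then obtain T where "\<forall>t. t < d \<longrightarrow> T t \<subseteq> T0 t \<and> rooted (T t) \<and> T t \<subseteq> {1..<2 ^ Suc r} \<and> card (T t) = l"
    by (rule choice[THEN exE])
  then have T: "T t \<subseteq> T0 t \<and> rooted (T t) \<and> T t \<subseteq> {1..<2 ^ Suc r} \<and> card (T t) = l" if "t < d" for t
    using that by blast
  have "\<exists>x\<in>X. u \<in> PiE {..<d} (\<lambda>t. anc (2 ^ r + x t))" if u: "u \<in> PiE {..<d} T" for u
  proof -
    have "\<exists>i<l. u t \<in> anc (D t i)" if "t < d" for t
    proof -
      have "u t \<in> T0 t" using T[OF that] PiE_mem[OF u, of t] that by auto
      then show ?thesis by (auto simp: T0_def)
    qed
    then have "\<forall>t. \<exists>i. t < d \<longrightarrow> i < l \<and> u t \<in> anc (D t i)" by blast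
    then obtain i where "\<forall>t. t < d \<longrightarrow> i t < l \<and> u t \<in> anc (D t (i t))"
      by (rule choice[THEN exE])
    then have i: "i t < l \<and> u t \<in> anc (D t (i t))" if "t < d" for t using that by blast
    define j where "j = (\<lambda>t\<in>{..<d}. i t)"
    have j: "j \<in> indices d (\<lambda>_. l)" using i by (auto simp: j_def indices_def)
    have "u t \<in> anc (2 ^ r + y j t)" if "t < d" for t
    proof (rule anc_trans)
      show "u t \<in> anc (D t (i t))" using i[OF that] by simp
      show "D t (i t) \<in> anc (2 ^ r + y j t)"
        by (rule Danc[OF that]) (use i[OF that] that j in \<open>auto simp: Y_def j_def\<close>)
    qed
    then have "u \<in> PiE {..<d} (\<lambda>t. anc (2 ^ r + y j t))" using u by (simp add: PiE_iff)
    then show ?thesis by (rule bexI[OF _ y[OF j]])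
  qed
  then show ?thesis using T by (intro exI[of _ T]) simp
qed

subsection \<open>The random construction\<close>

text \<open>In probabilistic terms, the zero set of a uniform function misses \<open>A\<close> with
  probability \<open>(1 - 1 / m) ^ card A\<close>: on \<open>A\<close> one of the \<open>m\<close>
  values is forbidden, elsewhere none.\<close>

lemma card_unhit:
  assumes "finite U" "A \<subseteq> U" "m \<ge> 1"
  shows "real (card {f \<in> U \<rightarrow>\<^sub>E {..<m}. \<forall>u\<in>A. f u \<noteq> 0}) = real m ^ card U * (1 - 1 / real m) ^ card A"
proof -
  have eq: "{f \<in> U \<rightarrow>\<^sub>E {..<m}. \<forall>u\<in>A. f u \<noteq> 0} = (\<Pi>\<^sub>E u\<in>U. if u \<in> A then {1..<m} else {..<m})"
  proof (intro set_eqI iffI)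
    fix f assume "f \<in> {f \<in> U \<rightarrow>\<^sub>E {..<m}. \<forall>u\<in>A. f u \<noteq> 0}"
    then show "f \<in> (\<Pi>\<^sub>E u\<in>U. if u \<in> A then {1..<m} else {..<m})"
      by (auto simp: PiE_iff)
  next
    fix f assume f: "f \<in> (\<Pi>\<^sub>E u\<in>U. if u \<in> A then {1..<m} else {..<m})"
    then have "f u < m" if "u \<in> U" for u
      using that by (auto simp: PiE_iff split: if_splits)
    moreover have "f u \<noteq> 0" if "u \<in> A" for u
      using that f assms(2) by (fastforce simp: PiE_iff)
    ultimately show "f \<in> {f \<in> U \<rightarrow>\<^sub>E {..<m}. \<forall>u\<in>A. f u \<noteq> 0}"
      using f by (auto simp: PiE_iff)
  qed
  have "card {f \<in> U \<rightarrow>\<^sub>E {..<m}. \<forall>u\<in>A. f u \<noteq> 0} = (\<Prod>u\<in>U. if u \<in> A then m - 1 else m)"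
    unfolding eq using assms(1) by (simp add: card_PiE if_distrib[of card] cong: if_cong)
  also have "real \<dots> = (\<Prod>u\<in>U. real m * (if u \<in> A then 1 - 1 / real m else 1))"
    unfolding of_nat_prod by (rule prod.cong) (use assms(3) in \<open>auto simp: field_simps of_nat_diff\<close>)
  also have "\<dots> = real m ^ card U * (\<Prod>u\<in>U. if u \<in> A then 1 - 1 / real m else 1)"
    by (simp add: prod.distrib)
  also have "(\<Prod>u\<in>U. if u \<in> A then 1 - 1 / real m else 1) = (1 - 1 / real m) ^ card A"
    using assms(1,2) by (simp add: prod.If_cases Int_absorb1)
  finally show ?thesis .
qed

text \<open>\<open>K\<close> is a random subset of \<open>U\<close> of density $1/m$, the zero set of a uniform \<open>f \<in> U \<rightarrow>\<^sub>E {..<m}\<close>.\<close>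

lemma random_hitting_set:
  fixes S :: "'x \<Rightarrow> 'u set"
  assumes "finite U" "finite X" "X \<noteq> {}" "finite \<F>" "m \<ge> 2"
    and S: "\<And>x. x \<in> X \<Longrightarrow> S x \<subseteq> U \<and> card (S x) \<le> p"
    and F: "\<And>F. F \<in> \<F> \<Longrightarrow> F \<subseteq> U \<and> card F = q"
    and bound: "real (card \<F>) * (1 - 1 / real m) ^ q \<le> (1 - 1 / real m) ^ p / 2"
  shows "\<exists>K. (\<forall>F\<in>\<F>. F \<inter> K \<noteq> {}) \<and>
    (1 - 1 / real m) ^ p / 2 * real (card X) \<le> real (card {x \<in> X. S x \<inter> K = {}})"
proof -
  define \<Omega> where "\<Omega> = U \<rightarrow>\<^sub>E {..<m}"
  define W where "W = real m ^ card U"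
  define \<theta> where "\<theta> = 1 - 1 / real m"
  have \<theta>: "0 < \<theta>" "\<theta> \<le> 1" using assms(5) by (auto simp: \<theta>_def field_simps)
  define ok where "ok f A \<longleftrightarrow> (\<forall>u\<in>A. f u \<noteq> 0)" for f :: "'u \<Rightarrow> nat" and A
  define Bad where "Bad = {f \<in> \<Omega>. \<exists>F\<in>\<F>. ok f F}"
  \<comment> \<open>The score counts the surviving points and subtracts \<open>card X\<close> as
    soon as some member of \<open>\<F>\<close> is missed. A positive score thus forces every member
    to be hit.\<close>
  define g where "g f = (\<Sum>x\<in>X. of_bool (ok f (S x))) - real (card X) * of_bool (f \<in> Bad)" for f
  have fin: "finite \<Omega>" unfolding \<Omega>_def using assms(1) by (simp add: finite_PiE)
  have W: "real (card \<Omega>) = W" "W > 0"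
    using assms(1,5) by (auto simp: \<Omega>_def W_def card_PiE)
  have cnt: "real (card {f \<in> \<Omega>. ok f A}) = W * \<theta> ^ card A" if "A \<subseteq> U" for A
    unfolding \<Omega>_def ok_def W_def \<theta>_def by (rule card_unhit) (use assms that in auto)
  have sum_of_bool: "(\<Sum>f\<in>\<Omega>. of_bool (Q f)) = real (card {f \<in> \<Omega>. Q f})" for Q
    using fin by (simp add: sum.If_cases of_bool_def Int_def)
  \<comment> \<open>Union bound over \<open>\<F>\<close>.\<close>
  have "real (card Bad) \<le> real (card \<F>) * (W * \<theta> ^ q)"
  proof -
    have "Bad = (\<Union>F\<in>\<F>. {f \<in> \<Omega>. ok f F})" by (auto simp: Bad_def)
    then have "card Bad \<le> (\<Sum>F\<in>\<F>. card {f \<in> \<Omega>. ok f F})"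
      by (simp only: card_UN_le[OF assms(4)])
    then have "real (card Bad) \<le> (\<Sum>F\<in>\<F>. real (card {f \<in> \<Omega>. ok f F}))"
      unfolding of_nat_sum[symmetric] by (rule of_nat_mono)
    also have "\<dots> = (\<Sum>F\<in>\<F>. W * \<theta> ^ q)"
    proof (rule sum.cong)
      fix F assume "F \<in> \<F>"
      then show "real (card {f \<in> \<Omega>. ok f F}) = W * \<theta> ^ q" using cnt[of F] F[of F] by simp
    qed simp
    finally show ?thesis by simp
  qed
  also have "\<dots> = W * (real (card \<F>) * \<theta> ^ q)" by simp
  also have "\<dots> \<le> W * (\<theta> ^ p / 2)" using bound W(2) by (intro mult_left_mono) (auto simp: \<theta>_def)
  finally have bad: "real (card Bad) \<le> W * (\<theta> ^ p / 2)" .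
  have "(\<Sum>f\<in>\<Omega>. g f) = (\<Sum>f\<in>\<Omega>. \<Sum>x\<in>X. of_bool (ok f (S x))) - real (card X) * (\<Sum>f\<in>\<Omega>. of_bool (f \<in> Bad))"
    by (simp add: g_def sum_subtractf sum_distrib_left)
  also have "(\<Sum>f\<in>\<Omega>. of_bool (f \<in> Bad)) = real (card Bad)"
    by (subst sum_of_bool) (auto simp: Bad_def)
  also have "(\<Sum>f\<in>\<Omega>. \<Sum>x\<in>X. of_bool (ok f (S x))) = (\<Sum>x\<in>X. W * \<theta> ^ card (S x))"
    by (subst sum.swap) (use S cnt in \<open>auto simp: sum_of_bool intro!: sum.cong\<close>)
  finally have "(\<Sum>f\<in>\<Omega>. g f) = (\<Sum>x\<in>X. W * \<theta> ^ card (S x)) - real (card X) * real (card Bad)" .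
  moreover have "(\<Sum>x\<in>X. W * \<theta> ^ card (S x)) \<ge> (\<Sum>x\<in>X. W * \<theta> ^ p)"
    using S W \<theta> by (intro sum_mono mult_left_mono power_decreasing) auto
  moreover have "real (card X) * real (card Bad) \<le> real (card X) * (W * (\<theta> ^ p / 2))"
    using bad by (intro mult_left_mono) auto
  \<comment> \<open>On average at least \<open>\<theta> ^ p * card X\<close> points survive, and the
    penalty costs at most half of this.\<close>
  ultimately have tot: "(\<Sum>f\<in>\<Omega>. g f) \<ge> W * (\<theta> ^ p / 2 * real (card X))" by (simp add: algebra_simps)
  have "\<exists>f\<in>\<Omega>. g f \<ge> \<theta> ^ p / 2 * real (card X)"
  proof (rule ccontr)
    assume "\<not> ?thesis"
    then have "(\<Sum>f\<in>\<Omega>. g f) < (\<Sum>f\<in>\<Omega>. \<theta> ^ p / 2 * real (card X))"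
      using fin W by (intro sum_strict_mono) (auto simp: not_le)
    then show False using tot W by simp
  qed
  then obtain f where f: "f \<in> \<Omega>" "g f \<ge> \<theta> ^ p / 2 * real (card X)" by blast
  have pos: "0 < \<theta> ^ p / 2 * real (card X)" using \<theta> assms(2,3) by (simp add: card_gt_0_iff)
  have sumX: "(\<Sum>x\<in>X. of_bool (ok f (S x))) = real (card {x \<in> X. ok f (S x)})"
    using assms(2) by (simp add: sum.If_cases of_bool_def Int_def)
  have "f \<notin> Bad"
  proof
    assume "f \<in> Bad"
    then have "g f = real (card {x \<in> X. ok f (S x)}) - real (card X)" by (simp add: g_def sumX)
    also have "\<dots> \<le> 0" using assms(2) by (simp add: card_mono)
    finally show False using f pos by simp
  qed
  moreover from this have "g f = real (card {x \<in> X. ok f (S x)})" by (simp add: g_def sumX)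
  moreover have "ok f A \<longleftrightarrow> A \<inter> {u. f u = 0} = {}" for A by (auto simp: ok_def)
  ultimately show ?thesis
    using f by (intro exI[of _ "{u. f u = 0}"]) (auto simp: Bad_def \<theta>_def)
qed

lemma card_indices: "card (indices d (\<lambda>_. n)) = n ^ d"
  by (simp add: indices_def card_PiE)

lemma finite_indices: "finite (indices d s)"
  by (simp add: indices_def finite_PiE)

text \<open>A killing set \<open>K\<close> that meets every product of \<open>d\<close> rooted
  subtrees with \<open>l\<close> nodes leaves no grid: by \<open>grid_rooted\<close>, a grid among
  the survivors would yield such a product with all its tuples above survivors, hence outside
  \<open>K\<close>. There are at most \<open>4 ^ (d * l)\<close> products, and a cell has at most
  \<open>Suc r ^ d\<close> tuples of ancestors.\<close>

lemma exists_gridfree: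
  assumes "2 \<le> m" "1 \<le> l"
    and bound: "4 ^ (d * l) * (1 - 1 / real m) ^ (l ^ d) \<le> (1 - 1 / real m) ^ (Suc r ^ d) / 2"
  shows "\<exists>X \<subseteq> indices d (\<lambda>_. 2 ^ r). \<not> grid d l X \<and>
    (1 - 1 / real m) ^ (Suc r ^ d) / 2 * 2 ^ (r * d) \<le> real (card X)"
proof -
  define V :: "nat set" where "V = {1..<2 ^ Suc r}"
  define U where "U = {..<d} \<rightarrow>\<^sub>E V"
  define C where "C = indices d (\<lambda>_. 2 ^ r)"
  define S where "S x = (\<Pi>\<^sub>E t\<in>{..<d}. anc (2 ^ r + x t))" for x
  define \<T> where "\<T> = {T. rooted T \<and> T \<subseteq> V \<and> card T = l}"
  define \<F> where "\<F> = PiE {..<d} ` ({..<d} \<rightarrow>\<^sub>E \<T>)"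
  have finT: "finite \<T>" unfolding \<T>_def by (rule finite_subset[of _ "Pow V"]) (auto simp: V_def)
  have leaf: "2 ^ r + x t < 2 ^ Suc r" if "x \<in> C" "t < d" for x t
    using that by (auto simp: C_def indices_def)
  have "card \<F> \<le> card ({..<d} \<rightarrow>\<^sub>E \<T>)"
    unfolding \<F>_def using finT by (intro card_image_le finite_PiE) auto
  also have "\<dots> = card \<T> ^ d" using finT by (simp add: card_PiE)
  also have "\<dots> \<le> (4 ^ l) ^ d"
    unfolding \<T>_def by (rule power_mono[OF card_rooted[OF assms(2)]]) (simp_all add: V_def)
  also have "\<dots> = 4 ^ (d * l)" by (metis power_mult mult.commute)
  finally have "real (card \<F>) \<le> real (4 ^ (d * l))" by (rule of_nat_mono)
  then have cF: "real (card \<F>) \<le> 4 ^ (d * l)" by simp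
  have "\<exists>K. (\<forall>F\<in>\<F>. F \<inter> K \<noteq> {}) \<and>
    (1 - 1 / real m) ^ (Suc r ^ d) / 2 * real (card C) \<le> real (card {x \<in> C. S x \<inter> K = {}})"
  proof (rule random_hitting_set[where U = U and q = "l ^ d"])
    show "finite U" by (simp add: U_def V_def finite_PiE)
    show "finite C" by (simp add: C_def finite_indices)
    show "C \<noteq> {}" 
    proof
      assume "C = {}"
      then have "(2 ^ r) ^ d = (0::nat)" using card_indices[of d "2 ^ r"] by (simp add: C_def)
      then show False by simp
    qed
    show "finite \<F>" using finT by (simp add: \<F>_def finite_PiE)
    show "2 \<le> m" by fact
    show "S x \<subseteq> U \<and> card (S x) \<le> Suc r ^ d" if "x \<in> C" for x
    proof
      show "S x \<subseteq> U" unfolding S_def U_def V_def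
        by (rule PiE_mono) (use anc_le leaf[OF that] in fastforce)
      have "card (S x) = (\<Prod>t<d. card (anc (2 ^ r + x t)))" by (simp add: S_def card_PiE)
      also have "\<dots> \<le> (\<Prod>t<d. Suc r)"
        by (rule prod_mono) (use card_anc leaf[OF that] in auto)
      finally show "card (S x) \<le> Suc r ^ d" by simp
    qed
    show "F \<subseteq> U \<and> card F = l ^ d" if F: "F \<in> \<F>" for F
    proof -
      obtain T where T: "F = PiE {..<d} T" "T \<in> {..<d} \<rightarrow>\<^sub>E \<T>"
        using F unfolding \<F>_def by (rule imageE)
      have T': "T t \<subseteq> V \<and> card (T t) = l" if "t < d" for t
        using PiE_mem[OF T(2), of t] that by (simp add: \<T>_def)
      show ?thesis using T' unfolding T(1) U_def by (auto simp: card_PiE intro!: PiE_mono)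
    qed
    have "real (card \<F>) * (1 - 1 / real m) ^ (l ^ d) \<le> 4 ^ (d * l) * (1 - 1 / real m) ^ (l ^ d)"
      using cF assms(1) by (intro mult_right_mono zero_le_power) auto
    then show "real (card \<F>) * (1 - 1 / real m) ^ (l ^ d) \<le> (1 - 1 / real m) ^ (Suc r ^ d) / 2"
      using bound by linarith
  qed
  then obtain K where K: "\<And>F. F \<in> \<F> \<Longrightarrow> F \<inter> K \<noteq> {}"
    "(1 - 1 / real m) ^ (Suc r ^ d) / 2 * real (card C) \<le> real (card {x \<in> C. S x \<inter> K = {}})" by blast
  let ?X = "{x \<in> C. S x \<inter> K = {}}"
  have "\<not> grid d l ?X"
  proof
    assume g: "grid d l ?X"
    have "?X \<subseteq> indices d (\<lambda>_. 2 ^ r)" by (auto simp: C_def)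
    from grid_rooted[OF g this assms(2)] obtain T
      where T: "(\<forall>t<d. rooted (T t) \<and> T t \<subseteq> {1..<2 ^ Suc r} \<and> card (T t) = l) \<and>
        (\<forall>u\<in>PiE {..<d} T. \<exists>x\<in>?X. u \<in> PiE {..<d} (\<lambda>t. anc (2 ^ r + x t)))" ..
    \<comment> \<open>\<open>T\<close> is arbitrary outside the \<open>d\<close> directions; its
      restriction is one of the functions that index \<open>\<F>\<close>.\<close>
    have "PiE {..<d} T = PiE {..<d} (restrict T {..<d})" by (rule PiE_cong) simp
    moreover have "restrict T {..<d} \<in> {..<d} \<rightarrow>\<^sub>E \<T>" using T unfolding \<T>_def V_def by simp
    ultimately have "PiE {..<d} T \<in> \<F>" unfolding \<F>_def by (rule image_eqI)
    then obtain u where u: "u \<in> PiE {..<d} T" "u \<in> K" using K(1) by blast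
    then obtain x where "x \<in> ?X" "u \<in> S x" using T unfolding S_def by blast
    then show False using u(2) by blast
  qed
  moreover have "real (card C) = 2 ^ (r * d)" by (simp add: C_def card_indices power_mult)
  ultimately show ?thesis using K(2) by (intro exI[of _ ?X]) (auto simp: C_def)
qed

subsection \<open>From pattern containment to grids\<close>

text \<open>Pointwise form of containment: \<open>e t\<close> enumerates the selected indices in
  increasing order and replaces the sorted lists of \<open>submatrix\<close>.\<close>

definition embedding ::
  "nat \<Rightarrow> shape \<Rightarrow> matrix \<Rightarrow> shape \<Rightarrow> matrix \<Rightarrow> (nat \<Rightarrow> nat \<Rightarrow> nat) \<Rightarrow> bool" where
  "embedding d a A p P e \<longleftrightarrow>
     (\<forall>t<d. \<forall>j<p t. \<forall>i<j. e t i < e t j) \<and>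
     (\<forall>x\<in>indices d p. (\<lambda>t\<in>{..<d}. e t (x t)) \<in> indices d a \<and>
        (P x = 1 \<longrightarrow> A (\<lambda>t\<in>{..<d}. e t (x t)) = 1))"

lemma embedding_less: "embedding d a A p P e \<Longrightarrow> t < d \<Longrightarrow> i < j \<Longrightarrow> j < p t \<Longrightarrow> e t i < e t j"
  by (simp add: embedding_def)

lemma embedding_range:
  "embedding d a A p P e \<Longrightarrow> x \<in> indices d p \<Longrightarrow> (\<lambda>t\<in>{..<d}. e t (x t)) \<in> indices d a"
  by (simp add: embedding_def)

lemma embedding_one:
  "embedding d a A p P e \<Longrightarrow> x \<in> indices d p \<Longrightarrow> P x = 1 \<Longrightarrow> A (\<lambda>t\<in>{..<d}. e t (x t)) = 1"
  by (simp add: embedding_def)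

lemma contains_embedding:
  assumes "contains d a A p P" "A \<in> zo_matrices d a"
  obtains e where "embedding d a A p P e"
proof -
  from assms(1) obtain S where S: "\<And>t. t < d \<Longrightarrow> S t \<subseteq> {..<a t} \<and> card (S t) = p t"
    and le: "\<And>i. i \<in> indices d p \<Longrightarrow> P i \<le> submatrix d S A i"
    unfolding contains_def by auto
  define e where "e t = (!) (sorted_list_of_set (S t))" for t
  have fin: "finite (S t)" if "t < d" for t using S[OF that] finite_subset by blast
  have ind: "indices d (\<lambda>t. card (S t)) = indices d p"
    unfolding indices_def by (rule PiE_cong) (simp add: S)
  have inc: "e t i < e t j" if "t < d" "i < j" "j < p t" for t i j
    using sorted_wrt_nth_less[OF strict_sorted_list_of_set[of "S t"] that(2)] S[OF that(1)] that(3)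
    by (simp add: e_def)
  have range: "(\<lambda>t\<in>{..<d}. e t (x t)) \<in> indices d a" if x: "x \<in> indices d p" for x
  proof -
    have "e t (x t) < a t" if t: "t < d" for t
    proof -
      have "x t < p t" using x t by (auto simp: indices_def)
      then have "e t (x t) \<in> set (sorted_list_of_set (S t))"
        unfolding e_def by (intro nth_mem) (simp add: S[OF t])
      then show ?thesis using S[OF t] fin[OF t] by auto
    qed
    then show ?thesis by (simp add: indices_def)
  qed
  have "A (\<lambda>t\<in>{..<d}. e t (x t)) = 1" if x: "x \<in> indices d p" "P x = 1" for x
  proof -
    have "1 \<le> A (\<lambda>t\<in>{..<d}. e t (x t))"
      using le[OF x(1)] x by (simp add: submatrix_def ind e_def)
    moreover have "A (\<lambda>t\<in>{..<d}. e t (x t)) \<in> {0, 1}"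
      using assms(2) range[OF x(1)] unfolding zo_matrices_def by (rule PiE_mem)
    ultimately show ?thesis by auto
  qed
  with inc range have "embedding d a A p P e" by (simp add: embedding_def)
  then show thesis by (rule that)
qed

section \<open>Contractions as monotone coordinate maps\<close>

lemma mono_collapse: "mono (collapse u v)"
  by (auto simp: mono_def collapse_def)

text \<open>Each contraction acts on one coordinate by the monotone map \<open>collapse\<close>, so
  a sequence of contractions composes to one monotone map per direction, and every one of the result
  lifts to a one of the original.\<close>

lemma contracts_to_mono:
  assumes "contracts_to d a A c C" "A \<in> zo_matrices d a"
  shows "C \<in> zo_matrices d c \<and> (\<exists>\<phi>. (\<forall>t. mono (\<phi> t)) \<and>
    (\<forall>y\<in>indices d c. C y = 1 \<longrightarrow> (\<exists>x\<in>indices d a. A x = 1 \<and> (\<forall>t<d. \<phi> t (x t) = y t))))"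
  using assms
proof (induction rule: contracts_to.induct)
  case (refl a A)
  then show ?case by (auto intro!: exI[of _ "\<lambda>_. id"] simp: mono_def)
next
  case (step a A b B t u v)
  let ?c = "contract_shape t u v b"
  from step obtain \<phi> where mono: "\<And>t. mono (\<phi> t)"
    and \<phi>: "\<And>y. y \<in> indices d b \<Longrightarrow> B y = 1 \<Longrightarrow>
      \<exists>x\<in>indices d a. A x = 1 \<and> (\<forall>t<d. \<phi> t (x t) = y t)" by blast
  define \<psi> where "\<psi> = \<phi>(t := collapse u v \<circ> \<phi> t)"
  have "mono (\<psi> t')" for t'
    using mono mono_collapse[of u v] by (auto simp: \<psi>_def mono_def)
  moreover have "\<exists>x\<in>indices d a. A x = 1 \<and> (\<forall>t'<d. \<psi> t' (x t') = y t')"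
    if y: "y \<in> indices d ?c" "contract d t u v b B y = 1" for y
  proof -
    have "\<exists>z\<in>indices d b. z(t := collapse u v (z t)) = y \<and> B z = 1"
      using y(2) unfolding contract_def restrict_apply'[OF y(1)] by (metis zero_neq_one)
    then obtain z where z: "z \<in> indices d b" "z(t := collapse u v (z t)) = y" "B z = 1"
      by (elim bexE conjE)
    from \<phi>[OF z(1,3)] obtain x where x: "x \<in> indices d a" "A x = 1" "\<forall>t<d. \<phi> t (x t) = z t"
      by blast
    have "\<psi> t' (x t') = y t'" if "t' < d" for t'
      unfolding z(2)[symmetric] using x(3) that by (simp add: \<psi>_def)
    then show ?thesis using x(1,2) by blast
  qed
  moreover have "contract d t u v b B \<in> zo_matrices d ?c"
    by (auto simp: contract_def zo_matrices_def)
  ultimately show ?case by blast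
qed

text \<open>Every entry of the all-ones pattern lifts through the contractions to a one of
  \<open>P\<close>. Since a monotone map reflects strict inequalities, the lifted ones are ordered
  like the entries they come from.\<close>

lemma interval_minor_grid:
  assumes "interval_minor d a P (\<lambda>_. l) (all_ones d (\<lambda>_. l))" "P \<in> zo_matrices d a"
  shows "grid d l {x \<in> indices d a. P x = 1}"
proof -
  from assms(1) obtain c C where cC: "contracts_to d a P c C"
    "contains d c C (\<lambda>_. l) (all_ones d (\<lambda>_. l))"
    unfolding interval_minor_def by blast
  from contracts_to_mono[OF cC(1) assms(2)] have C: "C \<in> zo_matrices d c" ..
  from contracts_to_mono[OF cC(1) assms(2), THEN conjunct2]
  obtain \<phi> where \<phi>_all: "(\<forall>t. mono (\<phi> t)) \<and> (\<forall>y\<in>indices d c. C y = 1 \<longrightarrow>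
    (\<exists>x\<in>indices d a. P x = 1 \<and> (\<forall>t<d. \<phi> t (x t) = y t)))" ..
  have mono: "mono (\<phi> t)" for t using \<phi>_all by simp
  have \<phi>: "\<exists>x\<in>indices d a. P x = 1 \<and> (\<forall>t<d. \<phi> t (x t) = y t)"
    if "y \<in> indices d c" "C y = 1" for y
    using \<phi>_all that by simp
  obtain e where e: "embedding d c C (\<lambda>_. l) (all_ones d (\<lambda>_. l)) e"
    by (rule contains_embedding[OF cC(2) C])
  have "\<forall>j\<in>indices d (\<lambda>_. l). \<exists>x. x \<in> indices d a \<and> P x = 1 \<and> (\<forall>t<d. \<phi> t (x t) = e t (j t))"
  proof
    fix j assume j: "j \<in> indices d (\<lambda>_. l)"
    then have "all_ones d (\<lambda>_. l) j = 1" by (simp add: all_ones_def)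
    from \<phi>[OF embedding_range[OF e, OF j] embedding_one[OF e, OF j, OF this]]
    show "\<exists>x. x \<in> indices d a \<and> P x = 1 \<and> (\<forall>t<d. \<phi> t (x t) = e t (j t))" by auto
  qed
  then obtain y where y: "\<forall>j\<in>indices d (\<lambda>_. l). y j \<in> indices d a \<and> P (y j) = 1 \<and>
    (\<forall>t<d. \<phi> t (y j t) = e t (j t))"
    by (rule bchoice[THEN exE])
  show ?thesis unfolding grid_def
  proof (rule exI[of _ y], intro conjI ballI allI impI)
    show "y j \<in> {x \<in> indices d a. P x = 1}" if "j \<in> indices d (\<lambda>_. l)" for j
      using y that by simp
    show "y j t < y j' t"
      if j: "j \<in> indices d (\<lambda>_. l)" "j' \<in> indices d (\<lambda>_. l)" "t < d" "j t < j' t" for j j' t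
    proof (rule ccontr)
      assume "\<not> y j t < y j' t"
      then have "\<phi> t (y j' t) \<le> \<phi> t (y j t)" by (intro monoD[OF mono]) simp
      then have "e t (j' t) \<le> e t (j t)" using y j by simp
      moreover have "j' t < l" using j by (auto simp: indices_def)
      ultimately show False using embedding_less[OF e j(3,4)] by simp
    qed
  qed
qed

lemma mod_less_mod:
  fixes a b N :: nat
  assumes "a < b" "a div N = b div N"
  shows "a mod N < b mod N"
  by (metis add_less_cancel_left assms div_mult_mod_eq)

subsection \<open>Antichains of blocks\<close>

text \<open>Fixing a signed sum of the block coordinates selects an antichain for the order in which
  the directions with \<open>\<epsilon> t = - 1\<close> are reversed.\<close>

lemma exists_blocks:
  fixes \<epsilon> :: "nat \<Rightarrow> int"
  assumes X: "X \<subseteq> indices d (\<lambda>_. N)" and "1 \<le> s" "s * N \<le> n" "1 \<le> d"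
    and \<epsilon>: "\<And>t. \<bar>\<epsilon> t\<bar> \<le> 1"
  obtains Y \<sigma> where "Y \<subseteq> indices d (\<lambda>_. n)"
    and "\<And>x. x \<in> Y \<Longrightarrow> (\<lambda>t\<in>{..<d}. x t mod N) \<in> X"
    and "\<And>x. x \<in> Y \<Longrightarrow> (\<Sum>t<d. \<epsilon> t * int (x t div N)) = \<sigma>"
    and "s ^ (d - 1) * card X \<le> 3 * d * card Y"
proof -
  define w where "w b = (\<Sum>t<d. \<epsilon> t * int (b t))" for b :: index
  have "w b \<in> {- int (d * s)..int (d * s)}" if b: "b \<in> indices d (\<lambda>_. s)" for b
  proof -
    have "\<bar>w b\<bar> \<le> (\<Sum>t<d. \<bar>\<epsilon> t * int (b t)\<bar>)" unfolding w_def by (rule sum_abs)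
    also have "\<dots> \<le> (\<Sum>t<d. int s)"
    proof (rule sum_mono)
      fix t assume "t \<in> {..<d}"
      then have "b t < s" using b by (auto simp: indices_def)
      then show "\<bar>\<epsilon> t * int (b t)\<bar> \<le> int s"
        using mult_mono[OF \<epsilon>[of t], of "int (b t)" "int s"] by (simp add: abs_mult)
    qed
    finally show ?thesis by (auto simp: abs_le_iff)
  qed
  then have "w \<in> indices d (\<lambda>_. s) \<rightarrow> {- int (d * s)..int (d * s)}" by blast
  \<comment> \<open>Pigeonhole: the \<open>s ^ d\<close> blocks share at most
    \<open>2 * (d * s) + 1\<close> values of \<open>w\<close>, so some value is taken by at least
    \<open>s ^ (d - 1) / (3 * d)\<close> blocks.\<close>
  then obtain \<sigma> where \<sigma>: "card (indices d (\<lambda>_. s)) \<le>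
    card (w -` {\<sigma>} \<inter> indices d (\<lambda>_. s)) * card {- int (d * s)..int (d * s)}"
    using pigeonhole_card[of w "indices d (\<lambda>_. s)" "{- int (d * s)..int (d * s)}"]
    by (auto simp: finite_indices)
  define B where "B = w -` {\<sigma>} \<inter> indices d (\<lambda>_. s)"
  \<comment> \<open>The cell \<open>snd bx\<close> inside the block at position
    \<open>fst bx\<close>; \<open>mod N\<close> and \<open>div N\<close> recover the pair.\<close>
  define g where "g bx = (\<lambda>t\<in>{..<d}. N * fst bx t + snd bx t)" for bx :: "index \<times> index"
  have lt: "snd bx t < N" "fst bx t < s" if "bx \<in> B \<times> X" "t < d" for bx t
    using that X by (auto simp: B_def indices_def PiE_iff)
  have div: "g bx t div N = fst bx t" and mod: "g bx t mod N = snd bx t"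
    if "bx \<in> B \<times> X" "t < d" for bx t
    using lt[OF that] that(2) by (simp_all add: g_def)
  have ext: "fst bx \<in> extensional {..<d}" "snd bx \<in> extensional {..<d}" if "bx \<in> B \<times> X" for bx
    using that X by (auto simp: B_def indices_def PiE_iff)
  have "inj_on g (B \<times> X)"
  proof (rule inj_onI)
    fix p q assume pq: "p \<in> B \<times> X" "q \<in> B \<times> X" "g p = g q"
    have "fst p = fst q"
      by (rule extensionalityI[OF ext(1)[OF pq(1)] ext(1)[OF pq(2)]])
        (use div[OF pq(1)] div[OF pq(2)] pq(3) in \<open>metis lessThan_iff\<close>)
    moreover have "snd p = snd q"
      by (rule extensionalityI[OF ext(2)[OF pq(1)] ext(2)[OF pq(2)]])
        (use mod[OF pq(1)] mod[OF pq(2)] pq(3) in \<open>metis lessThan_iff\<close>)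
    ultimately show "p = q" by (rule prod_eqI)
  qed
  then have cY: "card (g ` (B \<times> X)) = card B * card X"
    by (simp add: card_image card_cartesian_product)
  have "s * s ^ (d - 1) = s ^ d" using assms(4) by (simp add: power_eq_if)
  also have "\<dots> \<le> card B * (2 * (d * s) + 1)"
  proof -
    have "card {- int (d * s)..int (d * s)} = nat (int (2 * (d * s) + 1))" by simp
    then have "card {- int (d * s)..int (d * s)} = 2 * (d * s) + 1" unfolding nat_int .
    then show ?thesis using \<sigma> by (simp only: card_indices B_def)
  qed
  also have "\<dots> \<le> card B * (3 * (d * s))" using assms(2,4) by (intro mult_left_mono) auto
  finally have "s * s ^ (d - 1) \<le> s * (3 * d * card B)" by (simp add: mult_ac)
  then have "s ^ (d - 1) \<le> 3 * d * card B" using assms(2) by simp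
  then have "s ^ (d - 1) * card X \<le> 3 * d * card (g ` (B \<times> X))"
    unfolding cY using mult_right_mono[of "s ^ (d - 1)" "3 * d * card B" "card X"] by (simp add: mult_ac)
  moreover have "g ` (B \<times> X) \<subseteq> indices d (\<lambda>_. n)"
  proof (rule image_subsetI)
    fix p assume p: "p \<in> B \<times> X"
    have "g p t < n" if t: "t < d" for t
    proof -
      have "N * fst p t + snd p t < N * Suc (fst p t)" using lt(1)[OF p t] by simp
      also have "\<dots> \<le> N * s" using lt(2)[OF p t] by (intro mult_left_mono) auto
      finally show ?thesis using assms(3) t by (simp add: g_def mult.commute)
    qed
    then show "g p \<in> indices d (\<lambda>_. n)" by (auto simp: indices_def g_def)
  qed
  moreover have "(\<lambda>t\<in>{..<d}. x t mod N) \<in> X" if x: "x \<in> g ` (B \<times> X)" for x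
  proof -
    from x obtain p where p: "x = g p" "p \<in> B \<times> X" by (rule imageE)
    have "(\<lambda>t\<in>{..<d}. x t mod N) = snd p"
      by (rule extensionalityI[OF _ ext(2)[OF p(2)]]) (simp_all add: p(1) mod[OF p(2)])
    then show ?thesis using p(2) by auto
  qed
  moreover have "(\<Sum>t<d. \<epsilon> t * int (x t div N)) = \<sigma>" if x: "x \<in> g ` (B \<times> X)" for x
  proof -
    from x obtain p where p: "x = g p" "p \<in> B \<times> X" by (rule imageE)
    have "(\<Sum>t<d. \<epsilon> t * int (x t div N)) = w (fst p)"
      unfolding w_def by (rule sum.cong) (simp_all add: p(1) div[OF p(2)])
    then show ?thesis using p(2) by (auto simp: B_def)
  qed
  ultimately show thesis by (intro that) 
qed

section \<open>Sets of cells as matrices avoiding \<open>P\<close>\<close>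

definition mat_of :: "nat \<Rightarrow> shape \<Rightarrow> index set \<Rightarrow> matrix" where
  "mat_of d s Y = (\<lambda>i\<in>indices d s. of_bool (i \<in> Y))"

lemma mat_of_zo: "mat_of d s Y \<in> zo_matrices d s"
  by (auto simp: mat_of_def zo_matrices_def)

lemma mat_of_one: "i \<in> indices d s \<Longrightarrow> mat_of d s Y i = 1 \<Longrightarrow> i \<in> Y"
  by (simp add: mat_of_def of_bool_def split: if_splits)

lemma card_le_ex_fun:
  assumes "Y \<subseteq> indices d (\<lambda>_. n)" "avoids d (\<lambda>_. n) (mat_of d (\<lambda>_. n) Y) p P"
  shows "card Y \<le> ex_fun n p P d"
proof -
  let ?M = "{ones d (\<lambda>_. n) A |A. A \<in> zo_matrices d (\<lambda>_. n) \<and> avoids d (\<lambda>_. n) A p P}"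
  have zo: "finite (zo_matrices d (\<lambda>_. n))"
    unfolding zo_matrices_def by (intro finite_PiE finite_indices) simp
  have "?M \<subseteq> ones d (\<lambda>_. n) ` zo_matrices d (\<lambda>_. n)" by blast
  then have fin: "finite ?M" by (rule finite_subset) (rule finite_imageI[OF zo])
  have "ones d (\<lambda>_. n) (mat_of d (\<lambda>_. n) Y) = card Y"
    unfolding ones_def by (rule arg_cong[of _ _ card]) (use assms(1) in \<open>auto simp: mat_of_def\<close>)
  then have "card Y \<in> ?M"
    using assms(2) mat_of_zo by (intro CollectI exI[of _ "mat_of d (\<lambda>_. n) Y"]) simp
  with fin show ?thesis unfolding ex_fun_def by (rule Max_ge)
qed

text \<open>In each direction the corner one has the first or the last index, so with the chosen
  signs each term of its signed block sum is at most the corresponding term of any other one of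
  \<open>P\<close>. All the sums equal \<open>\<sigma>\<close>, hence all the terms agree and the
  whole copy lies in a single block. There, reduction modulo \<open>N\<close> preserves the order
  and carries the grid of \<open>P\<close> into \<open>X\<close>.\<close>

lemma avoids_mat_of_blocks:
  assumes P: "P \<in> zo_matrices d (\<lambda>_. k)" "grid d l {x \<in> indices d (\<lambda>_. k). P x = 1}"
    and c: "c \<in> indices d (\<lambda>_. k)" "P c = 1" "\<And>t. t < d \<Longrightarrow> c t \<in> {0, k - 1}"
    and "\<not> grid d l X"
    and mod: "\<And>x. x \<in> Y \<Longrightarrow> (\<lambda>t\<in>{..<d}. x t mod N) \<in> X"
    and sum: "\<And>x. x \<in> Y \<Longrightarrow> (\<Sum>t<d. (if c t = 0 then 1 else - 1) * int (x t div N)) = \<sigma>"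
  shows "avoids d (\<lambda>_. n) (mat_of d (\<lambda>_. n) Y) (\<lambda>_. k) P"
proof
  assume "contains d (\<lambda>_. n) (mat_of d (\<lambda>_. n) Y) (\<lambda>_. k) P"
  then obtain e where e: "embedding d (\<lambda>_. n) (mat_of d (\<lambda>_. n) Y) (\<lambda>_. k) P e"
    by (rule contains_embedding[OF _ mat_of_zo])
  let ?O = "{x \<in> indices d (\<lambda>_. k). P x = 1}"
  have Y: "(\<lambda>t\<in>{..<d}. e t (x t)) \<in> Y" if "x \<in> ?O" for x
  proof (rule mat_of_one)
    show "(\<lambda>t\<in>{..<d}. e t (x t)) \<in> indices d (\<lambda>_. n)"
      by (rule embedding_range[OF e]) (use that in simp)
    show "mat_of d (\<lambda>_. n) Y (\<lambda>t\<in>{..<d}. e t (x t)) = 1"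
      by (rule embedding_one[OF e]) (use that in simp_all)
  qed
  have incle: "e t i \<le> e t j" if "t < d" "i \<le> j" "j < k" for t i j
    using embedding_less[OF e that(1) _ that(3), of i] that(2) by (cases "i = j") auto
  have block: "e t (x t) div N = e t (c t) div N" if x: "x \<in> ?O" and t: "t < d" for x t
  proof -
    define \<epsilon> :: "nat \<Rightarrow> int" where "\<epsilon> t = (if c t = 0 then 1 else - 1)" for t
    have s: "(\<Sum>t<d. \<epsilon> t * int (e t (z t) div N)) = \<sigma>" if "z \<in> ?O" for z
    proof -
      have "(\<Sum>t<d. \<epsilon> t * int (e t (z t) div N)) =
        (\<Sum>t<d. (if c t = 0 then 1 else - 1) * int ((\<lambda>t\<in>{..<d}. e t (z t)) t div N))"
        by (rule sum.cong) (simp_all add: \<epsilon>_def)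
      then show ?thesis using sum[OF Y[OF that]] by (rule trans)
    qed
    have le: "\<epsilon> t * int (e t (c t) div N) \<le> \<epsilon> t * int (e t (x t) div N)" if "t \<in> {..<d}" for t
    proof -
      have t: "t < d" "x t < k" "c t < k" using that x c(1) by (auto simp: indices_def)
      show ?thesis
      proof (cases "c t = 0")
        case True
        then have "e t (c t) \<le> e t (x t)" using t by (intro incle) auto
        then show ?thesis using True by (simp add: \<epsilon>_def div_le_mono)
      next
        case False
        then have "e t (x t) \<le> e t (c t)" using c(3)[OF t(1)] t by (intro incle) auto
        then show ?thesis using False by (simp add: \<epsilon>_def div_le_mono)
      qed
    qed
    have "\<epsilon> t * int (e t (c t) div N) = \<epsilon> t * int (e t (x t) div N)"
      by (rule sum_mono_inv[where I = "{..<d}", OF _ le]) (use s[of x] s[of c] x c t in simp_all)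
    then show ?thesis by (auto simp: \<epsilon>_def split: if_splits)
  qed
  have "grid d l X"
  proof (rule grid_image[OF P(2), of "\<lambda>x. \<lambda>t\<in>{..<d}. e t (x t) mod N"])
    show "(\<lambda>t\<in>{..<d}. e t (x t) mod N) \<in> X" if "x \<in> ?O" for x
    proof -
      have "(\<lambda>t\<in>{..<d}. (\<lambda>t\<in>{..<d}. e t (x t)) t mod N) = (\<lambda>t\<in>{..<d}. e t (x t) mod N)"
        by (rule restrict_ext) simp
      then show ?thesis using mod[OF Y[OF that]] by (simp only:)
    qed
    show "(\<lambda>t\<in>{..<d}. e t (x t) mod N) t < (\<lambda>t\<in>{..<d}. e t (x' t) mod N) t"
      if x: "x \<in> ?O" "x' \<in> ?O" and t: "t < d" "x t < x' t" for x x' t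
    proof -
      have "x' t < k" using x(2) t(1) by (auto simp: indices_def)
      then have "e t (x t) mod N < e t (x' t) mod N"
        using embedding_less[OF e t] block[OF x(1) t(1)] block[OF x(2) t(1)] by (intro mod_less_mod) simp_all
      then show ?thesis using t(1) by simp
    qed
  qed
  with assms(6) show False by contradiction
qed

text \<open>A strictly increasing map sends index \<open>m\<close> of direction 0 to an index at
  least \<open>m\<close>, where the matrix is zero, although \<open>P\<close> has a one in its cross
  section \<open>m\<close>.\<close>

lemma avoids_few_rows:
  assumes "permutation_matrix d k P" "1 \<le> d" "m < k"
  shows "avoids d (\<lambda>_. n) (mat_of d (\<lambda>_. n) {x \<in> indices d (\<lambda>_. n). x 0 < m}) (\<lambda>_. k) P"
proof
  assume "contains d (\<lambda>_. n) (mat_of d (\<lambda>_. n) {x \<in> indices d (\<lambda>_. n). x 0 < m}) (\<lambda>_. k) P"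
  then obtain e where e: "embedding d (\<lambda>_. n)
    (mat_of d (\<lambda>_. n) {x \<in> indices d (\<lambda>_. n). x 0 < m}) (\<lambda>_. k) P e"
    by (rule contains_embedding[OF _ mat_of_zo])
  have lt: "j \<le> e 0 j" if "j < k" for j
    using that
  proof (induction j)
    case (Suc j)
    then show ?case using embedding_less[OF e, of 0 j "Suc j"] assms(2) by simp
  qed simp
  from assms(1,2,3) obtain x where x: "x \<in> cross_section d (\<lambda>_. k) 0 m" "P x = 1"
    unfolding permutation_matrix_def by (metis less_le_trans zero_less_one)
  then have x': "x \<in> indices d (\<lambda>_. k)" "x 0 = m" by (simp_all add: cross_section_def)
  have "(\<lambda>t\<in>{..<d}. e t (x t)) \<in> {x \<in> indices d (\<lambda>_. n). x 0 < m}"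
    by (rule mat_of_one[OF embedding_range[OF e, OF x'(1)] embedding_one[OF e, OF x'(1) x(2)]])
  then have "e 0 m < m" using x'(2) assms(2) by simp
  then show False using lt[OF assms(3)] by simp
qed

lemma card_few_rows:
  assumes "1 \<le> d" "m \<le> n"
  shows "card {x \<in> indices d (\<lambda>_. n). x 0 < m} = m * n ^ (d - 1)"
proof -
  have "{x \<in> indices d (\<lambda>_. n). x 0 < m} = (\<Pi>\<^sub>E t\<in>{..<d}. if t = 0 then {..<m} else {..<n})"
  proof (intro set_eqI iffI)
    fix x assume "x \<in> (\<Pi>\<^sub>E t\<in>{..<d}. if t = 0 then {..<m} else {..<n})"
    then have x: "x \<in> extensional {..<d}" "\<And>t. t < d \<Longrightarrow> x t \<in> (if t = 0 then {..<m} else {..<n})"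
      by (auto simp: PiE_iff)
    have "x t < n" if "t < d" for t using x(2)[OF that] assms(2) by (auto split: if_splits)
    moreover have "x 0 < m" using x(2)[of 0] assms(1) by simp
    ultimately show "x \<in> {x \<in> indices d (\<lambda>_. n). x 0 < m}" using x(1) by (simp add: indices_def PiE_iff)
  qed (auto simp: indices_def PiE_iff)
  then have "card {x \<in> indices d (\<lambda>_. n). x 0 < m} = (\<Prod>t<d. if t = 0 then m else n)"
    by (simp add: card_PiE if_distrib[of card] cong: if_cong)
  also have "\<dots> = m * n ^ (d - 1)" using assms(1) by (cases d) (simp_all add: prod.lessThan_Suc_shift del: prod.lessThan_Suc)
  finally show ?thesis .
qed

subsection \<open>Choice of the parameters\<close>

text \<open>Combines \<open>ln (1 - x) \<ge> - x - 2 * x ^ 2\<close> with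
  \<open>2 * x ^ 2 \<le> x\<close> on this range.\<close>

lemma exp_le_one_minus:
  fixes x :: real
  assumes "0 \<le> x" "x \<le> 1 / 2"
  shows "exp (- (2 * x)) \<le> 1 - x"
proof -
  have "x * x \<le> x * (1 / 2)" using assms by (intro mult_left_mono)
  then have "- (2 * x) \<le> ln (1 - x)"
    using ln_one_minus_pos_lower_bound[OF assms] by (simp add: power2_eq_square)
  then have "exp (- (2 * x)) \<le> exp (ln (1 - x))" by simp
  then show ?thesis using assms by simp
qed

text \<open>\<open>R\<close> is the number of levels of the tree, a small multiple of
  \<open>l\<close>. It must be small enough that some \<open>m\<close> lets a cell survive with
  probability \<open>exp (- (R / 4))\<close> while the union bound over \<open>4 ^ (d * l)\<close>
  products still succeeds.\<close>

lemma exists_dense_gridfree: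
  fixes d l :: nat
  assumes "2 \<le> d" and R: "R = l div (16 * (d + 1))" "1 \<le> R"
  obtains X where "X \<subseteq> indices d (\<lambda>_. 2 ^ (R - 1))" "\<not> grid d l X"
    "exp (- (real R / 4)) / 2 * 2 ^ ((R - 1) * d) \<le> real (card X)"
proof -
  define D where "D = 16 * (d + 1)"
  \<comment> \<open>Chosen so that the \<open>R ^ d\<close> ancestor tuples of a cell contain
    \<open>R / 8\<close> killed ones on average.\<close>
  define m where "m = 8 * R ^ (d - 1)"
  define \<theta> where "\<theta> = 1 - 1 / real m"
  have DR: "D * R \<le> l" by (simp add: R(1) D_def)
  have "R \<le> D * R" by (simp add: D_def)
  then have Rl: "R \<le> l" using DR by (rule le_trans)
  have l1: "1 \<le> l" using Rl R(2) by simp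
  have R1: "1 \<le> R ^ (d - 1)" using R(2) by (rule one_le_power)
  have m2: "2 \<le> m" using R1 by (simp add: m_def)
  have dd: "z * z ^ (d - 1) = z ^ d" for z :: nat using assms(1) by (simp add: power_eq_if)
  have "8 * R ^ d = R * m" by (simp add: m_def dd[of R, symmetric])
  then have p: "real (R ^ d) / real m = real R / 8"
    using m2 by (simp add: field_simps flip: of_nat_power) (metis of_nat_mult of_nat_numeral)
  have "exp (- (real R / 4)) = exp (- (2 * (1 / real m))) ^ (R ^ d)"
    unfolding exp_of_nat_mult[symmetric] using p by (simp add: field_simps)
  also have "\<dots> \<le> \<theta> ^ (R ^ d)"
    unfolding \<theta>_def using m2 by (intro power_mono exp_le_one_minus) (auto simp: field_simps)
  finally have lower: "exp (- (real R / 4)) \<le> \<theta> ^ (R ^ d)" .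
  have "D * (l * R ^ (d - 1)) \<le> l * (D * R) ^ (d - 1)"
  proof -
    \<comment> \<open>Since \<open>d \<ge> 2\<close>, a factor \<open>D\<close> can be split off;
      its size \<open>16 * (d + 1)\<close> makes \<open>l ^ d / m\<close> at least
      \<open>2 * (d + 1) * l\<close>, which outweighs \<open>4 ^ (d * l)\<close>.\<close>
    have "D ^ 1 \<le> D ^ (d - 1)" using assms(1) by (intro power_increasing) (auto simp: D_def)
    then have "D * (l * R ^ (d - 1)) \<le> D ^ (d - 1) * (l * R ^ (d - 1))" by (intro mult_right_mono) auto
    then show ?thesis by (simp add: power_mult_distrib mult_ac)
  qed
  also have "\<dots> \<le> l * l ^ (d - 1)" using DR by (intro mult_left_mono power_mono) auto
  finally have "D * (l * R ^ (d - 1)) \<le> l ^ d" unfolding dd .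
  moreover have "D * (l * R ^ (d - 1)) = 2 * (d + 1) * l * m" by (simp add: D_def m_def algebra_simps)
  ultimately have "2 * (d + 1) * l * m \<le> l ^ d" by simp
  then have "real (2 * (d + 1) * l * m) \<le> real (l ^ d)" by (rule of_nat_mono)
  then have q: "2 * (real d + 1) * real l \<le> real (l ^ d) / real m"
    using m2 by (simp add: field_simps)
  have "\<theta> ^ (l ^ d) \<le> exp (- (1 / real m)) ^ (l ^ d)"
    unfolding \<theta>_def using m2 exp_ge_add_one_self[of "- (1 / real m)"]
    by (intro power_mono) (auto simp: field_simps)
  also have "\<dots> = exp (- (real (l ^ d) / real m))" unfolding exp_of_nat_mult[symmetric] by simp
  also have "\<dots> \<le> exp (- (2 * (real d + 1) * real l))" using q by simp
  finally have upper: "\<theta> ^ (l ^ d) \<le> exp (- (2 * (real d + 1) * real l))" .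
  have e1: "2 \<le> exp (1::real)" using exp_ge_add_one_self[of 1] by simp
  have "(4::real) = 2 ^ 2" by simp
  also have "\<dots> \<le> exp 1 ^ 2" by (rule power_mono[OF e1]) simp
  also have "\<dots> = exp 2" unfolding exp_of_nat_mult[symmetric] by simp
  finally have "(4::real) ^ (d * l) \<le> exp 2 ^ (d * l)" by (rule power_mono) simp
  also have "\<dots> = exp (2 * real d * real l)" unfolding exp_of_nat_mult[symmetric] by (simp add: mult_ac)
  finally have "4 ^ (d * l) * \<theta> ^ (l ^ d) \<le> exp (2 * real d * real l) * exp (- (2 * (real d + 1) * real l))"
    using upper m2 by (intro mult_mono) (auto simp: \<theta>_def)
  also have "\<dots> = exp (- real l) * exp (- real l)"
    unfolding exp_add[symmetric] by (simp add: algebra_simps)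
  \<comment> \<open>One of the two spare factors \<open>exp (- l)\<close> pays for the survival
    probability, the other for the factor \<open>1 / 2\<close>.\<close>
  also have "\<dots> \<le> exp (- (real R / 4)) * exp (- 1)"
    using Rl l1 by (intro mult_mono) auto
  also have "\<dots> \<le> exp (- (real R / 4)) * (1 / 2)"
    using e1 by (intro mult_left_mono) (auto simp: exp_minus field_simps)
  also have "\<dots> \<le> \<theta> ^ (R ^ d) / 2" using lower by simp
  finally have bound: "4 ^ (d * l) * (1 - 1 / real m) ^ (l ^ d) \<le> (1 - 1 / real m) ^ (Suc (R - 1) ^ d) / 2"
    using R(2) by (simp add: \<theta>_def)
  have "\<exists>X \<subseteq> indices d (\<lambda>_. 2 ^ (R - 1)). \<not> grid d l X \<and>
    (1 - 1 / real m) ^ (Suc (R - 1) ^ d) / 2 * 2 ^ ((R - 1) * d) \<le> real (card X)"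
    by (rule exists_gridfree[OF m2 l1 bound])
  then obtain X where X: "X \<subseteq> indices d (\<lambda>_. 2 ^ (R - 1))" "\<not> grid d l X"
    "(1 - 1 / real m) ^ (Suc (R - 1) ^ d) / 2 * 2 ^ ((R - 1) * d) \<le> real (card X)" by blast
  have "exp (- (real R / 4)) / 2 * 2 ^ ((R - 1) * d) \<le> \<theta> ^ (R ^ d) / 2 * 2 ^ ((R - 1) * d)"
    using lower by (intro mult_right_mono) auto
  also have "\<dots> \<le> real (card X)" using X(3) R(2) by (simp add: \<theta>_def)
  finally show thesis by (rule that[OF X(1,2)])
qed

lemma ln_2_ge_half: "1 / 2 \<le> ln (2::real)"
proof -
  have "exp (1::real) \<le> 2 ^ 2" using exp_le by simp
  then have "1 \<le> ln ((2::real) ^ 2)" by (subst ln_ge_iff) auto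
  moreover have "ln ((2::real) ^ 2) = 2 * ln 2" by (subst ln_realpow) auto
  ultimately show ?thesis by linarith
qed

text \<open>With blocks of side \<open>N = 2 ^ (R - 1)\<close>, the antichain carries at least
  \<open>s ^ (d - 1) * card X / (3 * d)\<close> cells, where \<open>s * N\<close> is at least
  \<open>n / 2\<close>. Dividing by \<open>n ^ (d - 1)\<close> leaves
  \<open>exp (- (R / 4)) * N\<close>, at least \<open>2 powr (R / 2) / 2\<close>, up to a factor
  depending on \<open>d\<close>; half of the exponent absorbs the constants.\<close>

lemma ex_fun_ge_large:
  assumes "2 \<le> d" and R: "R = l div (16 * (d + 1))" "8 * d + 12 \<le> R"
    and P: "permutation_matrix d k P" "has_corner_one d (\<lambda>_. k) P"
      "interval_minor d (\<lambda>_. k) P (\<lambda>_. l) (all_ones d (\<lambda>_. l))"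
    and n: "2 ^ (R - 1) \<le> n"
  shows "2 powr (real R / 4) \<le> real (ex_fun n (\<lambda>_. k) P d) / real n ^ (d - 1)"
proof -
  define N where "N = (2::nat) ^ (R - 1)"
  define s where "s = n div N"
  have N0: "0 < N" by (simp add: N_def)
  have s: "1 \<le> s" "s * N \<le> n"
    using n N0 by (simp_all add: s_def N_def div_greater_zero_iff Suc_le_eq)
  have "n < N * Suc s" using dividend_less_times_div[OF N0, of n] by (simp add: s_def)
  also have "\<dots> \<le> N * (2 * s)" using s(1) by (intro mult_left_mono) auto
  also have "\<dots> = 2 * (s * N)" by simp
  finally have n2: "n \<le> 2 * (s * N)" by (rule less_imp_le)
  have n0: "0 < n" using s N0 by (cases n) auto
  from P(1) have zo: "P \<in> zo_matrices d (\<lambda>_. k)" by (simp add: permutation_matrix_def)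
  from P(2) obtain c where c: "c \<in> indices d (\<lambda>_. k)" "\<And>t. t < d \<Longrightarrow> c t \<in> {0, k - 1}" "P c = 1"
    unfolding has_corner_one_def by blast
  obtain X where X: "X \<subseteq> indices d (\<lambda>_. N)" "\<not> grid d l X"
    "exp (- (real R / 4)) / 2 * 2 ^ ((R - 1) * d) \<le> real (card X)"
    using exists_dense_gridfree[OF assms(1) R(1)] R(2) unfolding N_def by auto
  have d1: "1 \<le> d" using assms(1) by simp
  have \<epsilon>: "\<bar>if c t = 0 then 1 else - 1\<bar> \<le> (1::int)" for t by simp
  obtain Y \<sigma> where Y: "Y \<subseteq> indices d (\<lambda>_. n)"
    "\<And>x. x \<in> Y \<Longrightarrow> (\<lambda>t\<in>{..<d}. x t mod N) \<in> X"
    "\<And>x. x \<in> Y \<Longrightarrow> (\<Sum>t<d. (if c t = 0 then 1 else - 1) * int (x t div N)) = \<sigma>"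
    "s ^ (d - 1) * card X \<le> 3 * d * card Y"
    by (rule exists_blocks[OF X(1) s d1, of "\<lambda>t. if c t = 0 then 1 else - 1", OF \<epsilon>]) blast
  have "avoids d (\<lambda>_. n) (mat_of d (\<lambda>_. n) Y) (\<lambda>_. k) P"
    by (rule avoids_mat_of_blocks[OF zo interval_minor_grid[OF P(3) zo] c(1,3,2) X(2) Y(2,3)])
  then have YE: "card Y \<le> ex_fun n (\<lambda>_. k) P d" by (rule card_le_ex_fun[OF Y(1)])
  \<comment> \<open>The threshold \<open>8 * d + 12\<close> is four times the exponent in
    \<open>6 * d * 2 ^ d \<le> 2 ^ (2 * d + 3)\<close>.\<close>
  have "6 * d \<le> 8 * 2 ^ d" using less_exp[of d] by linarith
  then have "6 * d * 2 ^ d \<le> 8 * 2 ^ d * 2 ^ d" by (rule mult_right_mono) simp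
  also have "\<dots> = 2 ^ (2 * d + 3)" unfolding mult_2 power_add by simp
  finally have "real (6 * d * 2 ^ d) \<le> real (2 ^ (2 * d + 3))" by (rule of_nat_mono)
  also have "\<dots> = 2 powr real (2 * d + 3)" by (subst powr_realpow) simp_all
  also have "\<dots> \<le> 2 powr (real R / 4)" using R(2) by (intro powr_mono) auto
  finally have const: "6 * real d * 2 ^ d \<le> 2 powr (real R / 4)" by simp
  have "2 powr (- (real R / 2)) \<le> exp (- (real R / 4))"
  proof -
    have "real R * (1 / 2) \<le> real R * ln 2" using ln_2_ge_half by (intro mult_left_mono) auto
    then show ?thesis by (simp add: powr_def)
  qed
  then have expo: "2 powr (- (real R / 2)) * 2 ^ R \<le> exp (- (real R / 4)) * 2 ^ R" by simp
  have twoR: "(2::real) ^ R = 2 * real N"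
    using R(2) by (simp add: N_def flip: power_Suc)
  have "2 powr (real R / 4) * (6 * real d * 2 ^ d) \<le> 2 powr (real R / 4) * 2 powr (real R / 4)"
    by (rule mult_left_mono[OF const]) simp
  also have "\<dots> = 2 powr (- (real R / 2)) * 2 powr real R" by (simp flip: powr_add)
  also have "\<dots> \<le> exp (- (real R / 4)) * (2 * real N)"
    using expo twoR by (simp add: powr_realpow)
  finally have key: "2 powr (real R / 4) * (6 * real d * 2 ^ d) \<le> exp (- (real R / 4)) * (2 * real N)" .
  have dd: "z * z ^ (d - 1) = z ^ d" for z :: real using assms(1) by (simp add: power_eq_if)
  have "real n \<le> real (2 * (s * N))" using n2 by (rule of_nat_mono)
  then have "real n \<le> 2 * (real s * real N)" by simp
  then have "real n ^ (d - 1) \<le> (2 * (real s * real N)) ^ (d - 1)" by (rule power_mono) simp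
  then have nd: "2 * real n ^ (d - 1) \<le> 2 ^ d * (real s ^ (d - 1) * real N ^ (d - 1))"
    unfolding power_mult_distrib dd[of 2, symmetric] by simp
  have "real N ^ d = 2 ^ ((R - 1) * d)" by (simp add: N_def power_mult)
  then have "real s ^ (d - 1) * (exp (- (real R / 4)) / 2 * real N ^ d) \<le> real s ^ (d - 1) * real (card X)"
    using X(3) by (intro mult_left_mono) auto
  also have "\<dots> = real (s ^ (d - 1) * card X)" by simp
  also have "\<dots> \<le> real (3 * d * card Y)" using Y(4) by (rule of_nat_mono)
  also have "\<dots> \<le> real (3 * d * ex_fun n (\<lambda>_. k) P d)"
    using YE by (intro of_nat_mono mult_left_mono) auto
  finally have low: "real s ^ (d - 1) * (exp (- (real R / 4)) / 2 * real N ^ d) \<le>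
    3 * real d * real (ex_fun n (\<lambda>_. k) P d)" by simp
  have "12 * real d * (2 powr (real R / 4) * real n ^ (d - 1)) =
    2 powr (real R / 4) * 6 * real d * (2 * real n ^ (d - 1))" by simp
  also have "\<dots> \<le> 2 powr (real R / 4) * 6 * real d * (2 ^ d * (real s ^ (d - 1) * real N ^ (d - 1)))"
    by (rule mult_left_mono[OF nd]) simp
  also have "\<dots> = 2 powr (real R / 4) * (6 * real d * 2 ^ d) * (real s ^ (d - 1) * real N ^ (d - 1))"
    by (simp add: mult_ac)
  also have "\<dots> \<le> exp (- (real R / 4)) * (2 * real N) * (real s ^ (d - 1) * real N ^ (d - 1))"
    by (rule mult_right_mono[OF key]) simp
  also have "\<dots> = 4 * (real s ^ (d - 1) * (exp (- (real R / 4)) / 2 * real N ^ d))"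
    by (simp add: mult_ac flip: dd[of "real N"])
  also have "\<dots> \<le> 4 * (3 * real d * real (ex_fun n (\<lambda>_. k) P d))"
    by (rule mult_left_mono[OF low]) simp
  finally have "12 * real d * (2 powr (real R / 4) * real n ^ (d - 1)) \<le>
    12 * real d * real (ex_fun n (\<lambda>_. k) P d)" by simp
  then have "2 powr (real R / 4) * real n ^ (d - 1) \<le> real (ex_fun n (\<lambda>_. k) P d)"
    using assms(1) by (subst (asm) mult_le_cancel_left_pos) auto
  then show ?thesis using n0 by (simp add: pos_le_divide_eq)
qed

lemma ex_fun_ge_two:
  assumes "permutation_matrix d k P" "1 \<le> d" "2 < k" "2 \<le> n"
  shows "2 \<le> real (ex_fun n (\<lambda>_. k) P d) / real n ^ (d - 1)"
proof -
  have "2 * n ^ (d - 1) \<le> ex_fun n (\<lambda>_. k) P d"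
    using card_le_ex_fun[OF _ avoids_few_rows[OF assms(1-3)], of n] card_few_rows[OF assms(2,4)] by auto
  then have "real (2 * n ^ (d - 1)) \<le> real (ex_fun n (\<lambda>_. k) P d)" by (rule of_nat_mono)
  then show ?thesis using assms(4) by (simp add: pos_le_divide_eq)
qed

section \<open>Combining the ranges of small and large \<open>l\<close>\<close>

theorem theorem2p1:
  fixes d :: nat
  assumes "d \<ge> 2"
  shows "\<exists>c::real. c > 0 \<and>
    (\<forall>(k::nat) (l::nat) (P::matrix) (n::nat).
       k > 0 \<longrightarrow> real l = root d (real k) \<longrightarrow> 20 dvd l \<longrightarrow>
       permutation_matrix d k P \<longrightarrow>
       has_corner_one d (\<lambda>_. k) P \<longrightarrow>
       interval_minor d (\<lambda>_. k) P (\<lambda>_. l) (all_ones d (\<lambda>_. l)) \<longrightarrow>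
       real n \<ge> 2 powr (root d (real k) / 20) \<longrightarrow>
       real (ex_fun n (\<lambda>_. k) P d) / real n ^ (d - 1) \<ge> 2 powr (c * root d (real k)))"
proof -
  define D where "D = 16 * (d + 1)"
  \<comment> \<open>Small enough for both ranges: \<open>c * l \<le> 1\<close> when
    \<open>R < 8 * d + 12\<close>, and otherwise \<open>c \<le> 1 / (8 * D)\<close> together with
    \<open>l \<le> 2 * D * R\<close> gives \<open>c * l \<le> R / 4\<close>.\<close>
  define c :: real where "c = 1 / (real D * real (8 * d + 12))"
  have D: "48 \<le> D" using assms by (simp add: D_def)
  have c0: "c > 0" using D by (simp add: c_def)
  show ?thesis
  proof (intro exI[of _ c] conjI allI impI)
    show "c > 0" by fact
    fix k l :: nat and P :: matrix and n :: nat
    assume k: "k > 0" and root: "real l = root d (real k)" and "20 dvd l"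
      and P: "permutation_matrix d k P" "has_corner_one d (\<lambda>_. k) P"
        "interval_minor d (\<lambda>_. k) P (\<lambda>_. l) (all_ones d (\<lambda>_. l))"
      and n: "real n \<ge> 2 powr (root d (real k) / 20)"
    define R where "R = l div D"
    have "real l > 0" using k assms by (simp add: root)
    \<comment> \<open>A positive multiple of 20 is at least 20; this yields \<open>2 < k\<close> and
      \<open>2 \<le> n\<close>, as the construction with two full cross sections requires.\<close>
    then have l20: "20 \<le> l" using \<open>20 dvd l\<close> by (auto dest: dvd_imp_le)
    have "real l ^ d = real k" using k assms by (simp add: root)
    then have "l ^ d = k" by (metis of_nat_eq_iff of_nat_power)
    moreover have "l ^ 1 \<le> l ^ d" using l20 assms by (intro power_increasing) auto
    ultimately have k2: "2 < k" using l20 by simp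
    have "2 powr 1 \<le> 2 powr (real l / 20)" using l20 by (intro powr_mono) auto
    then have n2: "2 \<le> n" using n root by simp
    have lR: "l < D * Suc R" using dividend_less_times_div[of D l] D by (simp add: R_def)
    have "2 powr (c * real l) \<le> real (ex_fun n (\<lambda>_. k) P d) / real n ^ (d - 1)"
    proof (cases "8 * d + 12 \<le> R")
      case True
      \<comment> \<open>As \<open>D\<close> is at least 20, the lower bound on \<open>n\<close>
        guarantees room for at least one block of side \<open>2 ^ (R - 1)\<close>.\<close>
      have "real (R - 1) \<le> real l / 20"
      proof -
        have "20 * R \<le> D * R" using D by (intro mult_right_mono) auto
        also have "\<dots> \<le> l" by (simp add: R_def)
        finally show ?thesis by simp
      qed
      then have "2 powr real (R - 1) \<le> real n" using n root by (smt (verit) powr_mono)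
      then have "real (2 ^ (R - 1)) \<le> real n" by (simp add: powr_realpow)
      then have "2 ^ (R - 1) \<le> n" by (simp only: of_nat_le_iff)
      then have "2 powr (real R / 4) \<le> real (ex_fun n (\<lambda>_. k) P d) / real n ^ (d - 1)"
        using ex_fun_ge_large[OF assms _ True P] by (simp add: R_def D_def)
      moreover have "c * real l \<le> real R / 4"
      proof -
        have "c \<le> 1 / (real D * 8)" unfolding c_def using D
          by (intro divide_left_mono mult_left_mono) auto
        then have "c * real l \<le> 1 / (real D * 8) * real l" by (rule mult_right_mono) simp
        also have "\<dots> \<le> 1 / (real D * 8) * (2 * real D * real R)"
        proof (rule mult_left_mono)
          have "D * Suc R \<le> D * (2 * R)" using True by (intro mult_left_mono) auto
          with lR have "l < D * (2 * R)" by (rule less_le_trans)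
          then have "l \<le> 2 * D * R" by (simp add: mult_ac)
          then have "real l \<le> real (2 * D * R)" by (rule of_nat_mono)
          then show "real l \<le> 2 * real D * real R" by simp
        qed simp
        also have "\<dots> = real R / 4" using D by simp
        finally show ?thesis .
      qed
      ultimately show ?thesis by (meson order_trans powr_mono one_le_numeral)
    next
      case False
      then have "D * Suc R \<le> D * (8 * d + 12)" by (intro mult_left_mono) auto
      with lR have "l < D * (8 * d + 12)" by (rule less_le_trans)
      then have "l \<le> D * (8 * d + 12)" by (rule less_imp_le)
      then have "real l \<le> real (D * (8 * d + 12))" by (rule of_nat_mono)
      then have "c * real l \<le> 1" using D by (simp add: c_def divide_le_eq)
      then have "2 powr (c * real l) \<le> 2 powr 1" by (intro powr_mono) auto
      also have "\<dots> \<le> real (ex_fun n (\<lambda>_. k) P d) / real n ^ (d - 1)"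
        using ex_fun_ge_two[OF P(1) _ k2 n2] assms by simp
      finally show ?thesis .
    qed
    then show "2 powr (c * root d (real k)) \<le> real (ex_fun n (\<lambda>_. k) P d) / real n ^ (d - 1)"
      by (simp only: root)
  qed
qed

end
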